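(* Consider the state-dependent DMC with noncausal CSI at the transmitter described in the context. For every $R_K\geq 0$ and $B\geq 0$, the covert capacity with noncausal CSI satisfies $$C_{\mathrm{nc}}\leq \max\big(I(U;Y)-I(U;S)\big),$$ where the maximum is over conditional PMFs $P_{U|S}$ on a finite set $\mathcal{U}$ with $|\mathcal{U}|\leq \min\{|\mathcal{X}|+|\mathcal{Y}|+|\mathcal{Z}|+|\mathcal{S}|-3,\ |\mathcal{X}|\cdot|\mathcal{S}|\}$ and functions $x:\mathcal{U}\times\mathcal{S}\to\mathcal{X}$, evaluated under the joint distribution $P_S(s)P_{U|S}(u|s)\mathbbm{1}\{x=x(u,s)\}P_{Y,Z|S,X}(y,z|s,x)$, subject to $P_Z=Q_0$ and $\mathrm{E}[b(X)]\leq B$.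
   Context: A state-dependent discrete memoryless channel consists of finite alphabets $\mathcal{X}$ (input), $\mathcal{S}$ (state), $\mathcal{Y}$ (receiver output), $\mathcal{Z}$ (warden output), a state PMF $P_S$, and a channel law $P_{Y,Z|S,X}$. Over $n$ uses, the state sequence $S^n$ is IID $\sim P_S$, and given $(X^n,S^n)$ the pairs $(Y_i,Z_i)$ are conditionally independent with law $P_{Y,Z|S,X}(\cdot,\cdot|S_i,X_i)$. A designated "no input" symbol $x_0\in\mathcal{X}$ is fixed, and $Q_0(z)=\sum_{s}P_S(s)P_{Z|S,X}(z|s,x_0)$; $Q_0^{\times n}$ is its $n$-fold product. It is assumed that $\mathrm{supp}(Q_0)=\mathcal{Z}$. A cost function $b:\mathcal{X}\to[0,\infty)$ is given, with $b(x^n)=\frac1n\sum_{i=1}^n b(x_i)$. A secret key $K$ uniform on $[1:2^{nR_K}]$ and a message $M$ uniform on $[1:2^{nR}]$ are mutually independent and independent of $S^n$; $K$ is known to transmitter and receiver, while $S^n$ is known only to the transmitter. With causal CSI, an $(2^{nR},2^{nR_K},n)$ code consists of an encoder producing $X_i$ as a function of $(M,K,S^i)$ (and possibly private randomness of the transmitter independent of $(M,K,S^n)$), $i\in[1:n]$, and a decoder mapping $(Y^n,K)$ to $\hat M$. With noncausal CSI, the encoder produces $X^n$ from $(M,K,S^n)$ (and possibly such private randomness). $P_e^{(n)}=P(\hat M\neq M)$, and $\widehat{P}_{Z^n}$ is the distribution of the warden's output $Z^n$ induced by the code. A rate $R$ is achievable (for given $R_K,B$) if there is a sequence of codes with $\limsup_{n}\mathrm{E}[b(X^n)]\leq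 B$, $P_e^{(n)}\to 0$, and $D(\widehat{P}_{Z^n}\|Q_0^{\times n})\to 0$. The covert capacity $C_{\mathrm{c}}$ (causal CSI) resp. $C_{\mathrm{nc}}$ (noncausal CSI) is the supremum of achievable rates. *)

theory Defs
  imports "HOL-Analysis.Analysis"
begin

definition seqs :: "nat \<Rightarrow> 'a list set" where
  "seqs n = {xs. length xs = n}"

definition is_pmf_on :: "'a set \<Rightarrow> ('a \<Rightarrow> real) \<Rightarrow> bool" where
  "is_pmf_on A p \<longleftrightarrow> (\<forall>a\<in>A. p a \<ge> 0) \<and> (\<Sum>a\<in>A. p a) = 1"

text \<open>Channel W s x y z = P_{Y,Z|S,X}(y,z|s,x) and its marginals.\<close>
definition chanY :: "('s \<Rightarrow> 'x \<Rightarrow> 'y \<Rightarrow> 'z::finite \<Rightarrow> real) \<Rightarrow> 's \<Rightarrow> 'x \<Rightarrow> 'y \<Rightarrow> real" where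
  "chanY W s x y = (\<Sum>z\<in>UNIV. W s x y z)"

definition chanZ :: "('s \<Rightarrow> 'x \<Rightarrow> 'y::finite \<Rightarrow> 'z \<Rightarrow> real) \<Rightarrow> 's \<Rightarrow> 'x \<Rightarrow> 'z \<Rightarrow> real" where
  "chanZ W s x z = (\<Sum>y\<in>UNIV. W s x y z)"

text \<open>No-input output distribution Q_0 at the warden.\<close>
definition Q0 :: "('s::finite \<Rightarrow> real) \<Rightarrow> ('s \<Rightarrow> 'x \<Rightarrow> 'y::finite \<Rightarrow> 'z \<Rightarrow> real) \<Rightarrow> 'x \<Rightarrow> 'z \<Rightarrow> real" where
  "Q0 PS W x0 z = (\<Sum>s\<in>UNIV. PS s * chanZ W s x0 z)"

definition seq_prob :: "('a \<Rightarrow> real) \<Rightarrow> 'a list \<Rightarrow> real" where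
  "seq_prob p xs = (\<Prod>i<length xs. p (xs ! i))"

definition chan_prod :: "('s \<Rightarrow> 'x \<Rightarrow> 'o \<Rightarrow> real) \<Rightarrow> 's list \<Rightarrow> 'x list \<Rightarrow> 'o list \<Rightarrow> real" where
  "chan_prod V ss xs os = (\<Prod>i<length ss. V (ss ! i) (xs ! i) (os ! i))"

text \<open>Size of an index set [1:2^{nR}] (indexed here as {0..<N}).\<close>
definition set_size :: "nat \<Rightarrow> real \<Rightarrow> nat" where
  "set_size n R = nat \<lceil>2 powr (real n * R)\<rceil>"

text \<open>A noncausal-CSI stochastic encoder: enc m k s^n x^n = P(X^n = x^n | M=m, K=k, S^n=s^n)
  (private randomness of the transmitter is captured by the conditional PMF).\<close>
definition nc_encoder :: "nat \<Rightarrow> nat \<Rightarrow> nat \<Rightarrow> (nat \<Rightarrow> nat \<Rightarrow> 's list \<Rightarrow> 'x list \<Rightarrow> real) \<Rightarrow> bool" where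
  "nc_encoder n NM NK enc \<longleftrightarrow>
     (\<forall>m<NM. \<forall>k<NK. \<forall>s\<in>seqs n. is_pmf_on (seqs n) (enc m k s))"

definition code_weight :: "nat \<Rightarrow> nat \<Rightarrow> ('s \<Rightarrow> real) \<Rightarrow> (nat \<Rightarrow> nat \<Rightarrow> 's list \<Rightarrow> 'x list \<Rightarrow> real)
     \<Rightarrow> nat \<Rightarrow> nat \<Rightarrow> 's list \<Rightarrow> 'x list \<Rightarrow> real" where
  "code_weight NM NK PS enc m k s x = (1 / (real NM * real NK)) * seq_prob PS s * enc m k s x"

definition error_prob :: "nat \<Rightarrow> nat \<Rightarrow> nat \<Rightarrow> ('s::finite \<Rightarrow> real) \<Rightarrow> ('s \<Rightarrow> 'x::finite \<Rightarrow> 'y::finite \<Rightarrow> 'z::finite \<Rightarrow> real)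
     \<Rightarrow> (nat \<Rightarrow> nat \<Rightarrow> 's list \<Rightarrow> 'x list \<Rightarrow> real) \<Rightarrow> ('y list \<Rightarrow> nat \<Rightarrow> nat) \<Rightarrow> real" where
  "error_prob n NM NK PS W enc dec =
     (\<Sum>m<NM. \<Sum>k<NK. \<Sum>s\<in>seqs n. \<Sum>x\<in>seqs n. \<Sum>y\<in>seqs n.
        code_weight NM NK PS enc m k s x * chan_prod (chanY W) s x y *
        (if dec y k \<noteq> m then 1 else 0))"

definition avg_cost :: "('x \<Rightarrow> real) \<Rightarrow> 'x list \<Rightarrow> real" where
  "avg_cost b xs = (\<Sum>i<length xs. b (xs ! i)) / real (length xs)"

definition expected_cost :: "nat \<Rightarrow> nat \<Rightarrow> nat \<Rightarrow> ('s::finite \<Rightarrow> real) \<Rightarrow> ('x::finite \<Rightarrow> real)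
     \<Rightarrow> (nat \<Rightarrow> nat \<Rightarrow> 's list \<Rightarrow> 'x list \<Rightarrow> real) \<Rightarrow> real" where
  "expected_cost n NM NK PS b enc =
     (\<Sum>m<NM. \<Sum>k<NK. \<Sum>s\<in>seqs n. \<Sum>x\<in>seqs n. code_weight NM NK PS enc m k s x * avg_cost b x)"

definition warden_dist :: "nat \<Rightarrow> nat \<Rightarrow> nat \<Rightarrow> ('s::finite \<Rightarrow> real) \<Rightarrow> ('s \<Rightarrow> 'x::finite \<Rightarrow> 'y::finite \<Rightarrow> 'z \<Rightarrow> real)
     \<Rightarrow> (nat \<Rightarrow> nat \<Rightarrow> 's list \<Rightarrow> 'x list \<Rightarrow> real) \<Rightarrow> 'z list \<Rightarrow> real" where
  "warden_dist n NM NK PS W enc zs =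
     (\<Sum>m<NM. \<Sum>k<NK. \<Sum>s\<in>seqs n. \<Sum>x\<in>seqs n.
        code_weight NM NK PS enc m k s x * chan_prod (chanZ W) s x zs)"

definition kl_div :: "'a set \<Rightarrow> ('a \<Rightarrow> real) \<Rightarrow> ('a \<Rightarrow> real) \<Rightarrow> real" where
  "kl_div A P Q = (\<Sum>a\<in>A. if P a = 0 then 0 else P a * ln (P a / Q a))"

definition nc_achievable :: "('s::finite \<Rightarrow> real) \<Rightarrow> ('s \<Rightarrow> 'x::finite \<Rightarrow> 'y::finite \<Rightarrow> 'z::finite \<Rightarrow> real)
     \<Rightarrow> 'x \<Rightarrow> ('x \<Rightarrow> real) \<Rightarrow> real \<Rightarrow> real \<Rightarrow> real \<Rightarrow> bool" where
  "nc_achievable PS W x0 b RK B R \<longleftrightarrow> R \<ge> 0 \<and>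
     (\<exists>(enc :: nat \<Rightarrow> nat \<Rightarrow> nat \<Rightarrow> 's list \<Rightarrow> 'x list \<Rightarrow> real) (dec :: nat \<Rightarrow> 'y list \<Rightarrow> nat \<Rightarrow> nat).
        (\<forall>n. nc_encoder n (set_size n R) (set_size n RK) (enc n)) \<and>
        limsup (\<lambda>n. ereal (expected_cost n (set_size n R) (set_size n RK) PS b (enc n))) \<le> ereal B \<and>
        (\<lambda>n. error_prob n (set_size n R) (set_size n RK) PS W (enc n) (dec n)) \<longlonglongrightarrow> 0 \<and>
        (\<lambda>n. kl_div (seqs n) (warden_dist n (set_size n R) (set_size n RK) PS W (enc n))
                 (seq_prob (Q0 PS W x0))) \<longlonglongrightarrow> 0)"

definition nc_covert_capacity :: "('s::finite \<Rightarrow> real) \<Rightarrow> ('s \<Rightarrow> 'x::finite \<Rightarrow> 'y::finite \<Rightarrow> 'z::finite \<Rightarrow> real)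
     \<Rightarrow> 'x \<Rightarrow> ('x \<Rightarrow> real) \<Rightarrow> real \<Rightarrow> real \<Rightarrow> ereal" where
  "nc_covert_capacity PS W x0 b RK B = Sup (ereal ` {R. nc_achievable PS W x0 b RK B R})"

definition mutual_info :: "'a set \<Rightarrow> 'b set \<Rightarrow> ('a \<Rightarrow> 'b \<Rightarrow> real) \<Rightarrow> real" where
  "mutual_info A B p = (\<Sum>a\<in>A. \<Sum>b\<in>B.
     if p a b = 0 then 0
     else p a b * log 2 (p a b / ((\<Sum>b'\<in>B. p a b') * (\<Sum>a'\<in>A. p a' b))))"

text \<open>Auxiliary alphabet U = {0..<k}; PUS s u = P_{U|S}(u|s); xf u s = x(u,s).\<close>
definition aux_bound :: "'s::finite itself \<Rightarrow> 'x::finite itself \<Rightarrow> 'y::finite itself \<Rightarrow> 'z::finite itself \<Rightarrow> nat" where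
  "aux_bound _ _ _ _ = min (CARD('x) + CARD('y) + CARD('z) + CARD('s) - 3) (CARD('x) * CARD('s))"

definition nc_feasible :: "('s::finite \<Rightarrow> real) \<Rightarrow> ('s \<Rightarrow> 'x::finite \<Rightarrow> 'y::finite \<Rightarrow> 'z::finite \<Rightarrow> real)
     \<Rightarrow> 'x \<Rightarrow> ('x \<Rightarrow> real) \<Rightarrow> real \<Rightarrow> nat \<Rightarrow> ('s \<Rightarrow> nat \<Rightarrow> real) \<Rightarrow> (nat \<Rightarrow> 's \<Rightarrow> 'x) \<Rightarrow> bool" where
  "nc_feasible PS W x0 b B k PUS xf \<longleftrightarrow>
     k \<le> aux_bound TYPE('s) TYPE('x) TYPE('y) TYPE('z) \<and>
     (\<forall>s. is_pmf_on {0..<k} (PUS s)) \<and>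
     (\<forall>z. (\<Sum>s\<in>UNIV. \<Sum>u<k. PS s * PUS s u * chanZ W s (xf u s) z) = Q0 PS W x0 z) \<and>
     (\<Sum>s\<in>UNIV. \<Sum>u<k. PS s * PUS s u * b (xf u s)) \<le> B"

definition nc_objective :: "('s::finite \<Rightarrow> real) \<Rightarrow> ('s \<Rightarrow> 'x \<Rightarrow> 'y::finite \<Rightarrow> 'z::finite \<Rightarrow> real)
     \<Rightarrow> nat \<Rightarrow> ('s \<Rightarrow> nat \<Rightarrow> real) \<Rightarrow> (nat \<Rightarrow> 's \<Rightarrow> 'x) \<Rightarrow> real" where
  "nc_objective PS W k PUS xf =
     mutual_info {0..<k} UNIV (\<lambda>u y. \<Sum>s\<in>UNIV. PS s * PUS s u * chanY W s (xf u s) y)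
     - mutual_info {0..<k} UNIV (\<lambda>u s. PS s * PUS s u)"

definition nc_upper_bound :: "('s::finite \<Rightarrow> real) \<Rightarrow> ('s \<Rightarrow> 'x::finite \<Rightarrow> 'y::finite \<Rightarrow> 'z::finite \<Rightarrow> real)
     \<Rightarrow> 'x \<Rightarrow> ('x \<Rightarrow> real) \<Rightarrow> real \<Rightarrow> ereal" where
  "nc_upper_bound PS W x0 b B =
     Sup {ereal (nc_objective PS W k PUS xf) | k PUS xf. nc_feasible PS W x0 b B k PUS xf}"

end

theory Submission
  imports Defs
begin

text \<open>With \<open>A = (M, K)\<close> and \<open>V\<^sub>i = (A, Y\<^sup>i\<^sup>-\<^sup>1, S\<^sub>i\<^sub>+\<^sub>1, \<dots>, S\<^sub>n)\<close>, the terms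
  \<open>H(V\<^sub>i, S\<^sub>i) - H(V\<^sub>i, Y\<^sub>i)\<close> telescope to \<open>H(A, S\<^sup>n) - H(A, Y\<^sup>n)\<close>, which replaces the Csiszar sum
  identity; Fano's inequality then bounds the rate by a single-letter expression up to a vanishing
  error. Conditionally on \<open>V\<^sub>i\<close> the input is a random function of the state. Splitting \<open>V\<^sub>i\<close> according
  to that function only increases the bound, since \<open>t log t\<close> is convex. The bound is then linear in
  the weights of the resulting atoms as long as the marginals of \<open>S\<close>, \<open>Y\<close>, \<open>Z\<close> and the expected cost
  (or the joint law of \<open>(S, X)\<close>) are kept, so a basic feasible solution yields the cardinality bound.
  Comparing the warden's law with exponentially tilted products of \<open>Q\<^sub>0\<close> shows that its time-averaged
  marginal converges to \<open>Q\<^sub>0\<close>, and compactness of the finitely many parameters gives a limit that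
  satisfies both constraints exactly.\<close>

subsection \<open>Sums over sequences\<close>

text \<open>At each blocklength the constraints hold only approximately, while the bound demands
  them exactly. The auxiliary alphabet is therefore cut down to a size independent of n before the
  limit is taken; only then do all single-letter choices lie in one compact set.

  The key belongs to A, so log |K| enters H(A, S^n) and the bound on H(A, Y^n) alike and cancels;
  this is why the key rate is absent from the result.

  In I(U;Y) - I(U;S) the terms H(U) cancel, leaving H(Y) - H(S) plus a sum over u of contributions
  to H(S|U) - H(Y|U). Each of them depends only on the mass P(u, s, x) and is homogeneous of degree
  one in it. Working with unnormalised masses avoids division by P(u), makes the contribution of a
  reweighted atom linear in its weight, and turns time sharing into a mere enlargement of the index
  set.

  For the warden only upper bounds P_Z(z) \<le> Q_0(z) are derived; since both laws sum to 1, these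
  force equality.\<close>

lemma finite_seqs [simp]: "finite (seqs n :: 'a::finite list set)"
  using finite_lists_length_eq[of "UNIV :: 'a set" n] by (simp add: seqs_def)

lemma sum_seqs_Suc:
  fixes F :: "'a::finite list \<Rightarrow> real"
  shows "(\<Sum>xs\<in>seqs (Suc n). F xs) = (\<Sum>a\<in>UNIV. \<Sum>xs\<in>seqs n. F (a # xs))"
proof -
  have "(\<Sum>a\<in>UNIV. \<Sum>xs\<in>seqs n. F (a # xs)) = (\<Sum>(a, xs)\<in>UNIV \<times> seqs n. F (a # xs))"
    by (simp add: sum.cartesian_product)
  also have "\<dots> = (\<Sum>xs\<in>seqs (Suc n). F xs)"
    by (rule sum.reindex_bij_witness[where i = "\<lambda>xs. (hd xs, tl xs)" and j = "\<lambda>(a, xs). a # xs"])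
       (auto simp: seqs_def length_Suc_conv)
  finally show ?thesis by simp
qed

lemma sum_seqs_prod:
  fixes V :: "nat \<Rightarrow> 'a::finite \<Rightarrow> real"
  shows "(\<Sum>xs\<in>seqs n. \<Prod>i<n. V i (xs ! i)) = (\<Prod>i<n. \<Sum>a\<in>UNIV. V i a)"
proof (induction n arbitrary: V)
  case 0
  have "seqs 0 = {[] :: 'a list}" by (auto simp: seqs_def)
  then show ?case by simp
next
  case (Suc n)
  have "(\<Sum>xs\<in>seqs (Suc n). \<Prod>i<Suc n. V i (xs ! i))
      = (\<Sum>a\<in>UNIV. V 0 a * (\<Sum>xs\<in>seqs n. \<Prod>i<n. V (Suc i) (xs ! i)))"
    by (simp add: sum_seqs_Suc prod.lessThan_Suc_shift sum_distrib_left del: prod.lessThan_Suc)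
  also have "\<dots> = (\<Prod>i<Suc n. \<Sum>a\<in>UNIV. V i a)"
    by (simp add: Suc.IH[of "\<lambda>i. V (Suc i)"] prod.lessThan_Suc_shift sum_distrib_right del: prod.lessThan_Suc)
  finally show ?case .
qed

text \<open>The value \<open>d\<close> only picks one representative for each choice of the other
  coordinates; the inner index set is then the same for every \<open>a\<close>, so coordinate
  \<open>i\<close> can be factored out of a product.\<close>

lemma sum_seqs_update:
  fixes F :: "'a::finite list \<Rightarrow> real"
  assumes "i < n"
  shows "(\<Sum>xs\<in>seqs n. F xs) = (\<Sum>a\<in>UNIV. \<Sum>xs\<in>{xs\<in>seqs n. xs ! i = d}. F (xs[i := a]))"
proof -
  have "(\<Sum>xs\<in>seqs n. F xs) = (\<Sum>a\<in>UNIV. \<Sum>xs\<in>{xs\<in>seqs n. xs ! i = a}. F xs)"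
    by (rule sum.group[symmetric]) auto
  also have "\<dots> = (\<Sum>a\<in>UNIV. \<Sum>xs\<in>{xs\<in>seqs n. xs ! i = d}. F (xs[i := a]))"
  proof (rule sum.cong[OF refl])
    fix a :: 'a
    show "(\<Sum>xs\<in>{xs\<in>seqs n. xs ! i = a}. F xs) = (\<Sum>xs\<in>{xs\<in>seqs n. xs ! i = d}. F (xs[i := a]))"
      by (rule sum.reindex_bij_witness[where i = "\<lambda>xs. xs[i := a]" and j = "\<lambda>xs. xs[i := d]"])
         (use assms in \<open>auto simp: seqs_def\<close>)
  qed
  finally show ?thesis .
qed

text \<open>Independence under a product law: \<open>F\<close> does not read coordinate
  \<open>i\<close>, so both sides reduce to the same sum \<open>R\<close> over the other
  coordinates.\<close>

lemma sum_seqs_coordinate: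
  fixes V :: "nat \<Rightarrow> 'a::finite \<Rightarrow> real"
  assumes i: "i < n" and V: "(\<Sum>a\<in>UNIV. V i a) = 1"
    and F: "\<And>xs a. xs \<in> seqs n \<Longrightarrow> F (xs[i := a]) = F xs"
  shows "(\<Sum>xs\<in>seqs n. (\<Prod>j<n. V j (xs ! j)) * F xs * (if xs ! i = b then 1 else 0))
       = V i b * (\<Sum>xs\<in>seqs n. (\<Prod>j<n. V j (xs ! j)) * F xs)"
proof -
  define D where "D = {xs\<in>seqs n. xs ! i = (undefined :: 'a)}"
  define R where "R = (\<Sum>xs\<in>D. (\<Prod>j\<in>{..<n} - {i}. V j (xs ! j)) * F xs)"
  have upd: "(\<Prod>j<n. V j (xs[i := a] ! j)) * F (xs[i := a])
      = V i a * ((\<Prod>j\<in>{..<n} - {i}. V j (xs ! j)) * F xs)" if "xs \<in> D" for xs a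
  proof -
    have "(\<Prod>j<n. V j (xs[i := a] ! j)) = V i (xs[i := a] ! i) * (\<Prod>j\<in>{..<n} - {i}. V j (xs[i := a] ! j))"
      using i by (subst prod.remove[of _ i]) auto
    also have "\<dots> = V i a * (\<Prod>j\<in>{..<n} - {i}. V j (xs ! j))"
      using that i by (auto simp: D_def seqs_def intro!: prod.cong)
    finally show ?thesis using that F by (simp add: D_def)
  qed
  have "(\<Sum>xs\<in>seqs n. (\<Prod>j<n. V j (xs ! j)) * F xs * (if xs ! i = b then 1 else 0))
      = (\<Sum>a\<in>UNIV. \<Sum>xs\<in>D. (\<Prod>j<n. V j (xs[i := a] ! j)) * F (xs[i := a]) * (if a = b then 1 else 0))"
    unfolding sum_seqs_update[OF i, where d = undefined] D_def[symmetric]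
    using i by (intro sum.cong refl) (auto simp: D_def seqs_def)
  also have "\<dots> = (\<Sum>a\<in>UNIV. V i a * R * (if a = b then 1 else 0))"
    by (intro sum.cong refl) (simp add: upd R_def sum_distrib_left)
  also have "\<dots> = V i b * R"
    by (simp add: if_distrib[of "(*) _"] cong: if_cong)
  finally have 1: "(\<Sum>xs\<in>seqs n. (\<Prod>j<n. V j (xs ! j)) * F xs * (if xs ! i = b then 1 else 0)) = V i b * R" .
  have "(\<Sum>xs\<in>seqs n. (\<Prod>j<n. V j (xs ! j)) * F xs)
      = (\<Sum>a\<in>UNIV. \<Sum>xs\<in>D. (\<Prod>j<n. V j (xs[i := a] ! j)) * F (xs[i := a]))"
    unfolding sum_seqs_update[OF i, where d = undefined] D_def[symmetric] ..
  also have "\<dots> = (\<Sum>a\<in>UNIV. V i a * R)"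
    by (intro sum.cong refl) (simp add: upd R_def sum_distrib_left)
  also have "\<dots> = R"
    using V by (simp flip: sum_distrib_right)
  finally show ?thesis using 1 by simp
qed

subsection \<open>Entropy on finite weighted sets\<close>

definition xlog :: "real \<Rightarrow> real" where
  "xlog t = t * log 2 t"

definition pr :: "'w set \<Rightarrow> ('w \<Rightarrow> real) \<Rightarrow> ('w \<Rightarrow> 'v) \<Rightarrow> 'v \<Rightarrow> real" where
  "pr \<Omega> p f v = (\<Sum>\<omega>\<in>\<Omega>. p \<omega> * (if f \<omega> = v then 1 else 0))"

text \<open>An expectation over the sample space instead of a sum over values, so \<open>f\<close>
  may map into an infinite type such as lists and no range has to be named.\<close>

definition ent :: "'w set \<Rightarrow> ('w \<Rightarrow> real) \<Rightarrow> ('w \<Rightarrow> 'v) \<Rightarrow> real" where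
  "ent \<Omega> p f = - (\<Sum>\<omega>\<in>\<Omega>. p \<omega> * log 2 (pr \<Omega> p f (f \<omega>)))"

lemma expectation_pr:
  assumes "finite \<Omega>" "finite A" "f ` \<Omega> \<subseteq> A"
  shows "(\<Sum>\<omega>\<in>\<Omega>. p \<omega> * g (f \<omega>)) = (\<Sum>v\<in>A. pr \<Omega> p f v * g v)"
proof -
  have "(\<Sum>v\<in>A. pr \<Omega> p f v * g v) = (\<Sum>v\<in>A. \<Sum>\<omega>\<in>\<Omega>. p \<omega> * (if f \<omega> = v then g v else 0))"
    unfolding pr_def sum_distrib_right by (intro sum.cong refl) auto
  also have "\<dots> = (\<Sum>\<omega>\<in>\<Omega>. \<Sum>v\<in>A. p \<omega> * (if f \<omega> = v then g v else 0))"
    by (rule sum.swap)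
  also have "\<dots> = (\<Sum>\<omega>\<in>\<Omega>. p \<omega> * g (f \<omega>))"
  proof (intro sum.cong refl)
    fix \<omega> assume "\<omega> \<in> \<Omega>"
    then have "f \<omega> \<in> A" using assms by auto
    then show "(\<Sum>v\<in>A. p \<omega> * (if f \<omega> = v then g v else 0)) = p \<omega> * g (f \<omega>)"
      using assms(2) by (simp flip: sum_distrib_left)
  qed
  finally show ?thesis by simp
qed

lemma ent_eq_sum_xlog:
  assumes "finite \<Omega>" "finite A" "f ` \<Omega> \<subseteq> A"
  shows "ent \<Omega> p f = - (\<Sum>v\<in>A. xlog (pr \<Omega> p f v))"
  using expectation_pr[OF assms, of p "\<lambda>v. log 2 (pr \<Omega> p f v)"] by (simp add: ent_def xlog_def)

text \<open>Entropy depends only on the partition of the sample space into level sets; this lets the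
  same information be read as different tuples.\<close>

lemma ent_cong_kernel:
  assumes "\<And>\<omega> \<omega>'. \<omega> \<in> \<Omega> \<Longrightarrow> \<omega>' \<in> \<Omega> \<Longrightarrow> f \<omega> = f \<omega>' \<longleftrightarrow> g \<omega> = g \<omega>'"
  shows "ent \<Omega> p f = ent \<Omega> p g"
proof -
  have "pr \<Omega> p f (f \<omega>) = pr \<Omega> p g (g \<omega>)" if "\<omega> \<in> \<Omega>" for \<omega>
    unfolding pr_def using assms that by (intro sum.cong refl) auto
  then show ?thesis by (simp add: ent_def)
qed

lemma pr_pos:
  assumes "finite \<Omega>" "\<And>\<omega>. \<omega> \<in> \<Omega> \<Longrightarrow> p \<omega> \<ge> 0" "\<omega> \<in> \<Omega>" "p \<omega> > 0"
  shows "pr \<Omega> p f (f \<omega>) > 0"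
  unfolding pr_def by (rule sum_pos2[of _ \<omega>]) (use assms in auto)

text \<open>Gibbs' inequality, from \<open>ln u \<le> u - 1\<close> at \<open>u = Q / P\<close>.
  Asking only for total mass at most 1 on the image of \<open>f\<close> spares an exact
  normalisation of the comparison law.\<close>

lemma ent_le_cross_entropy:
  assumes fin: "finite \<Omega>" and p: "\<And>\<omega>. \<omega> \<in> \<Omega> \<Longrightarrow> p \<omega> \<ge> 0" and p1: "(\<Sum>\<omega>\<in>\<Omega>. p \<omega>) = 1"
    and Q: "\<And>v. v \<in> f ` \<Omega> \<Longrightarrow> Q v \<ge> 0" "(\<Sum>v\<in>f ` \<Omega>. Q v) \<le> 1"
    and pos: "\<And>\<omega>. \<omega> \<in> \<Omega> \<Longrightarrow> p \<omega> > 0 \<Longrightarrow> Q (f \<omega>) > 0"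
  shows "ent \<Omega> p f \<le> - (\<Sum>\<omega>\<in>\<Omega>. p \<omega> * log 2 (Q (f \<omega>)))"
proof -
  let ?P = "pr \<Omega> p f"
  have *: "p \<omega> * (log 2 (Q (f \<omega>)) - log 2 (?P (f \<omega>))) \<le> p \<omega> * ((Q (f \<omega>) / ?P (f \<omega>) - 1) / ln 2)"
    if w: "\<omega> \<in> \<Omega>" for \<omega>
  proof (cases "p \<omega> = 0")
    case False
    then have "p \<omega> > 0" using p[OF w] by simp
    then have P: "?P (f \<omega>) > 0" "Q (f \<omega>) > 0"
      using pr_pos[OF fin p w] pos[OF w] by auto
    then have "log 2 (Q (f \<omega>)) - log 2 (?P (f \<omega>)) = ln (Q (f \<omega>) / ?P (f \<omega>)) / ln 2"
      by (simp add: log_def ln_div diff_divide_distrib)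
    also have "\<dots> \<le> (Q (f \<omega>) / ?P (f \<omega>) - 1) / ln 2"
      using P by (intro divide_right_mono ln_le_minus_one) auto
    finally show ?thesis using \<open>p \<omega> > 0\<close> by (intro mult_left_mono) auto
  qed simp
  have "(\<Sum>\<omega>\<in>\<Omega>. p \<omega> * (Q (f \<omega>) / ?P (f \<omega>))) = (\<Sum>v\<in>f ` \<Omega>. ?P v * (Q v / ?P v))"
    by (rule expectation_pr) (use fin in auto)
  also have "\<dots> \<le> (\<Sum>v\<in>f ` \<Omega>. Q v)"
    using Q by (intro sum_mono) auto
  finally have 1: "(\<Sum>\<omega>\<in>\<Omega>. p \<omega> * (Q (f \<omega>) / ?P (f \<omega>))) \<le> 1" using Q by simp
  have "(\<Sum>\<omega>\<in>\<Omega>. p \<omega> * (log 2 (Q (f \<omega>)) - log 2 (?P (f \<omega>))))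
      \<le> (\<Sum>\<omega>\<in>\<Omega>. p \<omega> * ((Q (f \<omega>) / ?P (f \<omega>) - 1) / ln 2))"
    by (intro sum_mono *)
  also have "\<dots> = ((\<Sum>\<omega>\<in>\<Omega>. p \<omega> * (Q (f \<omega>) / ?P (f \<omega>))) - (\<Sum>\<omega>\<in>\<Omega>. p \<omega>)) / ln 2"
    by (simp add: sum_divide_distrib right_diff_distrib diff_divide_distrib sum_subtractf)
  also have "\<dots> \<le> 0"
    using 1 p1 by (simp add: divide_nonpos_pos)
  finally show ?thesis
    by (simp add: ent_def right_diff_distrib sum_subtractf)
qed

subsection \<open>Basic feasible solutions\<close>

text \<open>Gaussian elimination: an equation with a nonzero coefficient at \<open>j0\<close> is
  solved for that unknown and substituted into the others, which leaves one equation and one unknown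
  less.\<close>

lemma homogeneous_system_nontrivial:
  fixes a :: "'i \<Rightarrow> 'j \<Rightarrow> real"
  assumes "finite I" "finite J" "card I < card J"
  shows "\<exists>r. (\<forall>i\<in>I. (\<Sum>j\<in>J. r j * a i j) = 0) \<and> (\<exists>j\<in>J. r j \<noteq> 0)"
  using assms
proof (induction I arbitrary: a J rule: finite_induct)
  case empty
  then obtain j where "j \<in> J" by (metis card.empty equals0I less_nat_zero_code)
  then show ?case by (intro exI[of _ "\<lambda>_. 1"]) auto
next
  case (insert i I)
  show ?case
  proof (cases "\<forall>j\<in>J. a i j = 0")
    case True
    have "card I < card J" using insert by simp
    from insert.IH[OF insert.prems(1) this, of a] True show ?thesis by auto
  next
    case False
    then obtain j0 where j0: "j0 \<in> J" "a i j0 \<noteq> 0" by blast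
    define K where "K = J - {j0}"
    have K: "finite K" "card I < card K" "J = insert j0 K" "j0 \<notin> K"
      using insert j0 by (auto simp: K_def)
    obtain \<mu> where \<mu>: "\<forall>i'\<in>I. (\<Sum>j\<in>K. \<mu> j * (a i' j - a i' j0 * a i j / a i j0)) = 0"
        and nz: "\<exists>j\<in>K. \<mu> j \<noteq> 0"
      using insert.IH[OF K(1,2), of "\<lambda>i' j. a i' j - a i' j0 * a i j / a i j0"] by blast
    define t where "t = - (\<Sum>j\<in>K. \<mu> j * a i j) / a i j0"
    define r where "r = \<mu>(j0 := t)"
    have sumJ: "(\<Sum>j\<in>J. r j * a i' j) = t * a i' j0 + (\<Sum>j\<in>K. \<mu> j * a i' j)" for i'
    proof -
      have "(\<Sum>j\<in>K. r j * a i' j) = (\<Sum>j\<in>K. \<mu> j * a i' j)"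
        using K(4) by (intro sum.cong refl) (auto simp: r_def)
      then show ?thesis unfolding K(3) using K(1,4) by (simp add: r_def)
    qed
    have "(\<Sum>j\<in>J. r j * a i j) = 0"
      unfolding sumJ using j0 by (simp add: t_def)
    moreover have "(\<Sum>j\<in>J. r j * a i' j) = 0" if "i' \<in> I" for i'
    proof -
      have "0 = (\<Sum>j\<in>K. \<mu> j * a i' j) - (\<Sum>j\<in>K. \<mu> j * a i j) * (a i' j0 / a i j0)"
        using \<mu>[rule_format, OF that]
        by (simp add: right_diff_distrib sum_subtractf sum_distrib_right sum_distrib_left sum_divide_distrib mult_ac)
      then show ?thesis unfolding sumJ t_def by (simp add: algebra_simps)
    qed
    moreover have "\<exists>j\<in>J. r j \<noteq> 0"
      using nz K by (auto simp: r_def)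
    ultimately show ?thesis by (intro exI[of _ r]) auto
  qed
qed

text \<open>The positive functional \<open>m\<close> is implied by the equality constraints; it makes the feasible set
  bounded, so that moving along any direction in the kernel reaches the boundary.\<close>

lemma basic_feasible_solution:
  fixes a :: "'i \<Rightarrow> 'j \<Rightarrow> real" and m g w :: "'j \<Rightarrow> real"
  assumes "finite I" "finite J" and "\<And>j. j \<in> J \<Longrightarrow> m j > 0"
    and "\<And>r. (\<And>i. i \<in> I \<Longrightarrow> (\<Sum>j\<in>J. r j * a i j) = 0) \<Longrightarrow> (\<Sum>j\<in>J. r j * m j) = 0"
    and "\<And>j. j \<in> J \<Longrightarrow> w j \<ge> 0"
  shows "\<exists>K v. K \<subseteq> J \<and> card K \<le> card I \<and> (\<forall>j\<in>K. v j \<ge> 0)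
    \<and> (\<forall>i\<in>I. (\<Sum>j\<in>K. v j * a i j) = (\<Sum>j\<in>J. w j * a i j))
    \<and> (\<Sum>j\<in>J. w j * g j) \<le> (\<Sum>j\<in>K. v j * g j)"
  using assms(2-)
proof (induction "card J" arbitrary: J w rule: less_induct)
  case less
  note fin = \<open>finite J\<close> and m = less.prems(2) and impl = less.prems(3) and w = less.prems(4)
  show ?case
  proof (cases "card J \<le> card I")
    case True
    then show ?thesis using w by (intro exI[of _ J] exI[of _ w]) auto
  next
    case False
    then obtain r0 where r0: "\<forall>i\<in>I. (\<Sum>j\<in>J. r0 j * a i j) = 0" "\<exists>j\<in>J. r0 j \<noteq> 0"
      using homogeneous_system_nontrivial[OF assms(1) fin, of a] by auto
    \<comment> \<open>Both signs of a kernel direction are admissible; the one that does not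
      decrease the objective is kept.\<close>
    define r where "r = (if (\<Sum>j\<in>J. r0 j * g j) \<ge> 0 then r0 else (\<lambda>j. - r0 j))"
    have r: "\<And>i. i \<in> I \<Longrightarrow> (\<Sum>j\<in>J. r j * a i j) = 0" "\<exists>j\<in>J. r j \<noteq> 0"
        "(\<Sum>j\<in>J. r j * g j) \<ge> 0"
      using r0 by (auto simp: r_def sum_negf)
    have "(\<Sum>j\<in>J. r j * m j) = 0" using impl r(1) by blast
    \<comment> \<open>A nonzero direction without negative entries would have a positive value under
      \<open>m\<close>, but this value is 0 on the kernel.\<close>
    have "\<exists>j\<in>J. r j < 0"
    proof (rule ccontr)
      assume "\<not> ?thesis"
      then have nn: "\<And>j. j \<in> J \<Longrightarrow> r j \<ge> 0" by force
      then have "\<forall>j\<in>J. r j * m j = 0"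
        using \<open>(\<Sum>j\<in>J. r j * m j) = 0\<close> m fin
        by (subst (asm) sum_nonneg_eq_0_iff) (auto intro!: mult_nonneg_nonneg simp: less_imp_le)
      then show False using r(2) m by force
    qed
    define N where "N = {j\<in>J. r j < 0}"
    have N: "finite N" "N \<noteq> {}" using fin \<open>\<exists>j\<in>J. r j < 0\<close> by (auto simp: N_def)
    define t where "t = Min ((\<lambda>j. w j / - r j) ` N)"
    have "t \<in> (\<lambda>j. w j / - r j) ` N" unfolding t_def using N by (intro Min_in) auto
    then obtain j0 where j0: "j0 \<in> N" "t = w j0 / - r j0" by blast
    have tle: "t \<le> w j / - r j" if "j \<in> N" for j unfolding t_def using N that by simp
    have t0: "t \<ge> 0" using j0 w by (auto simp: N_def intro!: divide_nonneg_neg divide_nonpos_neg)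
    define w' where "w' j = w j + t * r j" for j
    have w': "w' j \<ge> 0" if "j \<in> J" for j
    proof (cases "r j < 0")
      case True
      then show ?thesis using tle[of j] that by (simp add: N_def w'_def field_simps)
    next
      case False
      then show ?thesis using w[OF that] t0 by (simp add: w'_def)
    qed
    have w'0: "w' j0 = 0" using j0 by (simp add: w'_def N_def)
    define J' where "J' = J - {j0}"
    have j0J: "j0 \<in> J" using j0 by (simp add: N_def)
    have drop: "(\<Sum>j\<in>J'. w' j * h j) = (\<Sum>j\<in>J. w j * h j) + t * (\<Sum>j\<in>J. r j * h j)" for h
    proof -
      have "(\<Sum>j\<in>J'. w' j * h j) = (\<Sum>j\<in>J. w' j * h j)"
        unfolding J'_def using w'0 fin j0J by (subst sum.remove[OF fin j0J]) auto
      then show ?thesis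
        by (simp add: w'_def distrib_right sum.distrib sum_distrib_left mult.assoc)
    qed
    have "\<exists>K v. K \<subseteq> J' \<and> card K \<le> card I \<and> (\<forall>j\<in>K. v j \<ge> 0)
      \<and> (\<forall>i\<in>I. (\<Sum>j\<in>K. v j * a i j) = (\<Sum>j\<in>J'. w' j * a i j))
      \<and> (\<Sum>j\<in>J'. w' j * g j) \<le> (\<Sum>j\<in>K. v j * g j)"
    proof (rule less.hyps)
      show "card J' < card J" unfolding J'_def using fin j0J by (rule card_Diff1_less)
      show "finite J'" using fin by (simp add: J'_def)
      show "m j > 0" if "j \<in> J'" for j using that m by (simp add: J'_def)
      show "w' j \<ge> 0" if "j \<in> J'" for j using that w' by (simp add: J'_def)
      show "(\<Sum>j\<in>J'. \<mu> j * m j) = 0" if \<mu>: "\<And>i. i \<in> I \<Longrightarrow> (\<Sum>j\<in>J'. \<mu> j * a i j) = 0" for \<mu>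
      proof -
        have ext: "(\<Sum>j\<in>J. (\<mu>(j0 := 0)) j * h j) = (\<Sum>j\<in>J'. \<mu> j * h j)" for h
          unfolding J'_def by (subst sum.remove[OF fin j0J]) (auto intro!: sum.cong)
        show ?thesis using impl[of "\<mu>(j0 := 0)"] \<mu> unfolding ext by simp
      qed
    qed
    then obtain K v where K: "K \<subseteq> J'" "card K \<le> card I" "\<forall>j\<in>K. v j \<ge> 0"
      "\<forall>i\<in>I. (\<Sum>j\<in>K. v j * a i j) = (\<Sum>j\<in>J'. w' j * a i j)"
      "(\<Sum>j\<in>J'. w' j * g j) \<le> (\<Sum>j\<in>K. v j * g j)" by blast
    have "(\<Sum>j\<in>J. w j * g j) \<le> (\<Sum>j\<in>K. v j * g j)"
      using K(5) r(3) t0 unfolding drop by (smt (verit) mult_nonneg_nonneg)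
    moreover have "(\<Sum>j\<in>K. v j * a i j) = (\<Sum>j\<in>J. w j * a i j)" if "i \<in> I" for i
      using K(4) r(1)[OF that] that unfolding drop by simp
    ultimately show ?thesis using K(1-3) by (intro exI[of _ K] exI[of _ v]) (auto simp: J'_def)
  qed
qed

section \<open>Convexity of t log t and mutual information without quotients\<close>

lemma xlog_0 [simp]: "xlog 0 = 0"
  by (simp add: xlog_def)

lemma xlog_mult:
  assumes "t \<ge> 0" "u \<ge> 0"
  shows "xlog (t * u) = t * xlog u + u * xlog t"
proof (cases "t = 0 \<or> u = 0")
  case False
  then have "t > 0" "u > 0" using assms by auto
  then show ?thesis by (simp add: xlog_def log_mult algebra_simps)
qed (auto simp: xlog_def)

text \<open>This is \<open>ln u \<le> u - 1\<close> at \<open>u = t0 / t\<close>, multiplied by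
  \<open>t\<close>. At \<open>t = 0\<close> the tangent has the value \<open>- t0 / ln 2\<close>,
  which is negative.\<close>

lemma xlog_tangent:
  assumes "t \<ge> 0" "t0 > 0"
  shows "xlog t0 + (log 2 t0 + 1 / ln 2) * (t - t0) \<le> xlog t"
proof (cases "t = 0")
  case True
  then show ?thesis using assms by (simp add: xlog_def algebra_simps)
next
  case False
  then have t: "t > 0" using assms by simp
  have "t * ln (t0 / t) \<le> t * (t0 / t - 1)"
    using t assms by (intro mult_left_mono ln_le_minus_one) auto
  then have "t * (ln t0 - ln t) \<le> t0 - t"
    using t assms by (simp add: ln_div right_diff_distrib)
  then have "t * (ln t0 - ln t) / ln 2 \<le> (t0 - t) / ln 2"
    by (intro divide_right_mono) auto
  then show ?thesis
    by (simp add: xlog_def log_def algebra_simps diff_divide_distrib add_divide_distrib)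
qed

text \<open>Jensen's inequality, from the tangent at the mean. The slope is unbounded near 0, so a
  vanishing mean is treated apart: then every term is 0.\<close>

lemma xlog_sum_le:
  assumes fin: "finite F" and p: "\<And>i. i \<in> F \<Longrightarrow> p i \<ge> 0" and p1: "(\<Sum>i\<in>F. p i) = 1"
    and a: "\<And>i. i \<in> F \<Longrightarrow> a i \<ge> 0"
  shows "xlog (\<Sum>i\<in>F. p i * a i) \<le> (\<Sum>i\<in>F. p i * xlog (a i))"
proof (cases "(\<Sum>i\<in>F. p i * a i) = 0")
  case True
  then have "\<forall>i\<in>F. p i * a i = 0"
    using fin p a by (subst (asm) sum_nonneg_eq_0_iff) auto
  then have "(\<Sum>i\<in>F. p i * xlog (a i)) = 0"
    by (intro sum.neutral) (auto simp: xlog_def)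
  then show ?thesis using True by simp
next
  case False
  define t0 where "t0 = (\<Sum>i\<in>F. p i * a i)"
  have t0: "t0 > 0" using False p a by (simp add: t0_def sum_nonneg order_less_le)
  define C where "C = log 2 t0 + 1 / ln 2"
  have "xlog t0 = (\<Sum>i\<in>F. p i) * xlog t0 + C * ((\<Sum>i\<in>F. p i * a i) - (\<Sum>i\<in>F. p i) * t0)"
    using p1 by (simp add: t0_def)
  also have "\<dots> = (\<Sum>i\<in>F. p i * (xlog t0 + C * (a i - t0)))"
    by (simp add: distrib_left right_diff_distrib sum.distrib sum_subtractf sum_distrib_left sum_distrib_right mult_ac)
  also have "\<dots> \<le> (\<Sum>i\<in>F. p i * xlog (a i))"
    using t0 p a unfolding C_def by (intro sum_mono mult_left_mono xlog_tangent) auto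
  finally show ?thesis by (simp add: t0_def)
qed

text \<open>The identity I(A;B) = H(A) + H(B) - H(A,B). It has neither quotients nor a case
  distinction at 0, so the cancellation of H(U) and the continuity of the objective become
  visible.\<close>

lemma mutual_info_eq_xlog:
  assumes fin: "finite A" "finite B" and p: "\<And>a b. a \<in> A \<Longrightarrow> b \<in> B \<Longrightarrow> p a b \<ge> 0"
  shows "mutual_info A B p = (\<Sum>a\<in>A. \<Sum>b\<in>B. xlog (p a b))
    - (\<Sum>a\<in>A. xlog (\<Sum>b\<in>B. p a b)) - (\<Sum>b\<in>B. xlog (\<Sum>a\<in>A. p a b))"
proof -
  let ?r = "\<lambda>a. \<Sum>b\<in>B. p a b" and ?c = "\<lambda>b. \<Sum>a\<in>A. p a b"
  have "mutual_info A B p = (\<Sum>a\<in>A. \<Sum>b\<in>B. xlog (p a b) - p a b * log 2 (?r a) - p a b * log 2 (?c b))"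
    unfolding mutual_info_def
  proof (intro sum.cong refl)
    fix a b assume ab: "a \<in> A" "b \<in> B"
    show "(if p a b = 0 then 0 else p a b * log 2 (p a b / (?r a * ?c b)))
      = xlog (p a b) - p a b * log 2 (?r a) - p a b * log 2 (?c b)"
    proof (cases "p a b = 0")
      case False
      then have pos: "p a b > 0" using p[OF ab] by simp
      have r: "?r a > 0" by (rule sum_pos2[of _ b]) (use fin p ab pos in auto)
      have c: "?c b > 0" by (rule sum_pos2[of _ a]) (use fin p ab pos in auto)
      have "log 2 (p a b / (?r a * ?c b)) = log 2 (p a b) - log 2 (?r a) - log 2 (?c b)"
        using pos r c by (simp add: log_divide log_mult)
      then show ?thesis using pos by (simp add: xlog_def right_diff_distrib)
    qed simp
  qed
  also have "\<dots> = (\<Sum>a\<in>A. \<Sum>b\<in>B. xlog (p a b)) - (\<Sum>a\<in>A. \<Sum>b\<in>B. p a b * log 2 (?r a))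
      - (\<Sum>a\<in>A. \<Sum>b\<in>B. p a b * log 2 (?c b))"
    by (simp add: sum_subtractf)
  also have "(\<Sum>a\<in>A. \<Sum>b\<in>B. p a b * log 2 (?r a)) = (\<Sum>a\<in>A. xlog (?r a))"
    by (simp add: xlog_def sum_distrib_right)
  also have "(\<Sum>a\<in>A. \<Sum>b\<in>B. p a b * log 2 (?c b)) = (\<Sum>b\<in>B. xlog (?c b))"
    by (subst sum.swap) (simp add: xlog_def sum_distrib_right)
  finally show ?thesis .
qed

subsection \<open>Single-letter functionals\<close>

text \<open>The state, output and warden marginals and the expected cost all have this form for a
  suitable \<open>\<phi>\<close>; preserving them means preserving finitely many linear functionals
  of the mass \<open>\<mu>\<close>.\<close>

definition pairing :: "('s::finite \<Rightarrow> 'x::finite \<Rightarrow> real) \<Rightarrow> ('s \<Rightarrow> 'x \<Rightarrow> real) \<Rightarrow> real" where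
  "pairing \<mu> \<phi> = (\<Sum>s\<in>UNIV. \<Sum>x\<in>UNIV. \<mu> s x * \<phi> s x)"

definition out_mass ::
  "('s::finite \<Rightarrow> 'x::finite \<Rightarrow> 'y \<Rightarrow> 'z::finite \<Rightarrow> real) \<Rightarrow> ('s \<Rightarrow> 'x \<Rightarrow> real) \<Rightarrow> 'y \<Rightarrow> real" where
  "out_mass W \<mu> y = pairing \<mu> (\<lambda>s x. chanY W s x y)"

text \<open>For the conditional law of \<open>(S, X)\<close> given \<open>U = u\<close>, scaled by the probability of \<open>u\<close>,
  this is the contribution of \<open>u\<close> to \<open>H(S|U) - H(Y|U)\<close>; the scaling is harmless because the
  functional is homogeneous of degree one.\<close>

definition entropy_gap ::
  "('s::finite \<Rightarrow> 'x::finite \<Rightarrow> 'y::finite \<Rightarrow> 'z::finite \<Rightarrow> real) \<Rightarrow> ('s \<Rightarrow> 'x \<Rightarrow> real) \<Rightarrow> real" where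
  "entropy_gap W \<mu> = (\<Sum>y\<in>UNIV. xlog (out_mass W \<mu> y)) - (\<Sum>s\<in>UNIV. xlog (\<Sum>x\<in>UNIV. \<mu> s x))"

text \<open>An atom on which the input is the function \<open>f\<close> of the state, the shape
  demanded by x = x(u, s); \<open>q s\<close> plays the role of P(u, s).\<close>

definition graph_mass :: "('s \<Rightarrow> real) \<Rightarrow> ('s \<Rightarrow> 'x) \<Rightarrow> 's \<Rightarrow> 'x \<Rightarrow> real" where
  "graph_mass q f s x = (if x = f s then q s else 0)"

lemma pairing_graph_mass [simp]: "pairing (graph_mass q f) \<phi> = (\<Sum>s\<in>UNIV. q s * \<phi> s (f s))"
proof -
  have "(\<Sum>x\<in>UNIV. graph_mass q f s x * \<phi> s x) = q s * \<phi> s (f s)" for s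
    by (simp add: graph_mass_def if_distrib[of "\<lambda>t. t * _"] cong: if_cong)
  then show ?thesis by (simp add: pairing_def)
qed

lemma sum_graph_mass [simp]: "(\<Sum>x\<in>UNIV. graph_mass q f s (x :: 'x::finite)) = q s"
  by (simp add: graph_mass_def)

lemma pairing_sum_left: "pairing (\<lambda>s x. \<Sum>j\<in>J. \<mu> j s x) \<phi> = (\<Sum>j\<in>J. pairing (\<mu> j) \<phi>)"
proof -
  have "pairing (\<lambda>s x. \<Sum>j\<in>J. \<mu> j s x) \<phi> = (\<Sum>s\<in>UNIV. \<Sum>x\<in>UNIV. \<Sum>j\<in>J. \<mu> j s x * \<phi> s x)"
    by (simp add: pairing_def sum_distrib_right)
  also have "\<dots> = (\<Sum>s\<in>UNIV. \<Sum>j\<in>J. \<Sum>x\<in>UNIV. \<mu> j s x * \<phi> s x)"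
    by (intro sum.cong refl) (rule sum.swap)
  also have "\<dots> = (\<Sum>j\<in>J. pairing (\<mu> j) \<phi>)"
    unfolding pairing_def by (rule sum.swap)
  finally show ?thesis .
qed

lemma pairing_sum_right: "pairing \<mu> (\<lambda>s x. \<Sum>j\<in>J. \<phi> j s x) = (\<Sum>j\<in>J. pairing \<mu> (\<phi> j))"
  using pairing_sum_left[of "\<phi>" J \<mu>] by (simp add: pairing_def mult.commute)

lemma pairing_scale_left: "pairing (\<lambda>s x. t * \<mu> s x) \<phi> = t * pairing \<mu> \<phi>"
  by (simp add: pairing_def sum_distrib_left mult.assoc)

lemma pairing_diff_left: "pairing (\<lambda>s x. \<mu> s x - \<nu> s x) \<phi> = pairing \<mu> \<phi> - pairing \<nu> \<phi>"
  by (simp add: pairing_def left_diff_distrib sum_subtractf)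

lemma pairing_diff_right: "pairing \<mu> (\<lambda>s x. \<phi> s x - \<psi> s x) = pairing \<mu> \<phi> - pairing \<mu> \<psi>"
  by (simp add: pairing_def right_diff_distrib sum_subtractf)

lemma pairing_one: "pairing \<mu> (\<lambda>s x. 1) = (\<Sum>s\<in>UNIV. \<Sum>x\<in>UNIV. \<mu> s x)"
  by (simp add: pairing_def)

lemma pairing_state: "pairing \<mu> (\<lambda>s x. if s = s0 then 1 else 0) = (\<Sum>x\<in>UNIV. \<mu> s0 x)"
proof -
  have "(\<Sum>x\<in>UNIV. \<mu> s x * (if s = s0 then 1 else 0)) = (if s = s0 then \<Sum>x\<in>UNIV. \<mu> s x else 0)" for s
    by simp
  then show ?thesis by (simp add: pairing_def)
qed

lemma pairing_nonneg:
  "(\<And>s x. \<mu> s x \<ge> 0) \<Longrightarrow> (\<And>s x. \<phi> s x \<ge> 0) \<Longrightarrow> pairing \<mu> \<phi> \<ge> 0"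
  by (simp add: pairing_def sum_nonneg)

locale channel =
  fixes W :: "'s::finite \<Rightarrow> 'x::finite \<Rightarrow> 'y::finite \<Rightarrow> 'z::finite \<Rightarrow> real"
  assumes W: "\<And>s x. is_pmf_on UNIV (\<lambda>yz. W s x (fst yz) (snd yz))"
begin

lemma W_nonneg: "W s x y z \<ge> 0"
  using W[of s x] by (force simp: is_pmf_on_def)

lemma chanY_nonneg [simp]: "chanY W s x y \<ge> 0"
  by (simp add: chanY_def W_nonneg sum_nonneg)

lemma chanZ_nonneg [simp]: "chanZ W s x z \<ge> 0"
  by (simp add: chanZ_def W_nonneg sum_nonneg)

lemma sum_W: "(\<Sum>y\<in>UNIV. \<Sum>z\<in>UNIV. W s x y z) = 1"
proof -
  have "(\<Sum>y\<in>UNIV. \<Sum>z\<in>UNIV. W s x y z) = (\<Sum>yz\<in>UNIV \<times> UNIV. W s x (fst yz) (snd yz))"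
    by (simp add: sum.cartesian_product split_beta)
  then show ?thesis using W[of s x] by (simp add: is_pmf_on_def)
qed

lemma sum_chanY [simp]: "(\<Sum>y\<in>UNIV. chanY W s x y) = 1"
  by (simp add: chanY_def sum_W)

lemma sum_chanZ [simp]: "(\<Sum>z\<in>UNIV. chanZ W s x z) = 1"
  unfolding chanZ_def by (subst sum.swap) (rule sum_W)

lemma out_mass_nonneg: "(\<And>s x. \<mu> s x \<ge> 0) \<Longrightarrow> out_mass W \<mu> y \<ge> 0"
  by (simp add: out_mass_def pairing_nonneg)

lemma sum_out_mass: "(\<Sum>y\<in>UNIV. out_mass W \<mu> y) = (\<Sum>s\<in>UNIV. \<Sum>x\<in>UNIV. \<mu> s x)"
  unfolding out_mass_def by (simp flip: pairing_sum_right pairing_one)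

text \<open>Both sums produce an extra term, the total mass times \<open>xlog t\<close>. The output
  mass equals the state mass because the channel is stochastic, so these terms cancel.\<close>

lemma entropy_gap_scale:
  assumes "t \<ge> 0" "\<And>s x. \<mu> s x \<ge> 0"
  shows "entropy_gap W (\<lambda>s x. t * \<mu> s x) = t * entropy_gap W \<mu>"
proof -
  have "(\<Sum>y\<in>UNIV. xlog (t * out_mass W \<mu> y))
      = t * (\<Sum>y\<in>UNIV. xlog (out_mass W \<mu> y)) + (\<Sum>y\<in>UNIV. out_mass W \<mu> y) * xlog t"
    using assms by (simp add: xlog_mult out_mass_nonneg sum.distrib sum_distrib_left sum_distrib_right)
  moreover have "(\<Sum>s\<in>UNIV. xlog (t * (\<Sum>x\<in>UNIV. \<mu> s x)))
      = t * (\<Sum>s\<in>UNIV. xlog (\<Sum>x\<in>UNIV. \<mu> s x)) + (\<Sum>s\<in>UNIV. \<Sum>x\<in>UNIV. \<mu> s x) * xlog t"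
  proof -
    have "xlog (t * (\<Sum>x\<in>UNIV. \<mu> s x)) = t * xlog (\<Sum>x\<in>UNIV. \<mu> s x) + (\<Sum>x\<in>UNIV. \<mu> s x) * xlog t" for s
      using assms by (intro xlog_mult sum_nonneg) auto
    then show ?thesis
      by (simp only: sum.distrib sum_distrib_left[symmetric] sum_distrib_right[symmetric])
  qed
  ultimately show ?thesis
    by (simp add: entropy_gap_def out_mass_def pairing_scale_left right_diff_distrib
        sum_out_mass[unfolded out_mass_def] flip: sum_distrib_left)
qed

lemma nc_objective_eq_entropy_gap:
  assumes R: "\<And>u s. u < k \<Longrightarrow> PS s * PUS s u = R u s" "\<And>u s. u < k \<Longrightarrow> R u s \<ge> 0"
  shows "nc_objective PS W k PUS xf = (\<Sum>u<k. entropy_gap W (graph_mass (R u) (xf u)))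
    - (\<Sum>y\<in>UNIV. xlog (\<Sum>u<k. \<Sum>s\<in>UNIV. R u s * chanY W s (xf u s) y))
    + (\<Sum>s\<in>UNIV. xlog (\<Sum>u<k. R u s))"
proof -
  let ?p = "\<lambda>u y. \<Sum>s\<in>UNIV. PS s * PUS s u * chanY W s (xf u s) y"
  let ?q = "\<lambda>u y. \<Sum>s\<in>UNIV. R u s * chanY W s (xf u s) y"
  have pq: "?p u y = ?q u y" if "u < k" for u y using R(1)[OF that] by simp
  have rows: "(\<Sum>y\<in>UNIV. ?q u y) = (\<Sum>s\<in>UNIV. R u s)" for u
    by (subst sum.swap) (simp flip: sum_distrib_left)
  have 1: "mutual_info {0..<k} UNIV ?p = (\<Sum>u<k. \<Sum>y\<in>UNIV. xlog (?q u y))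
      - (\<Sum>u<k. xlog (\<Sum>s\<in>UNIV. R u s)) - (\<Sum>y\<in>UNIV. xlog (\<Sum>u<k. ?q u y))"
    by (subst mutual_info_eq_xlog) (auto simp: pq R(2) rows atLeast0LessThan intro!: sum_nonneg)
  have 2: "mutual_info {0..<k} UNIV (\<lambda>u s. PS s * PUS s u) = (\<Sum>u<k. \<Sum>s\<in>UNIV. xlog (R u s))
      - (\<Sum>u<k. xlog (\<Sum>s\<in>UNIV. R u s)) - (\<Sum>s\<in>UNIV. xlog (\<Sum>u<k. R u s))"
    by (subst mutual_info_eq_xlog) (auto simp: R atLeast0LessThan)
  show ?thesis
    unfolding nc_objective_def 1 2 by (simp add: entropy_gap_def out_mass_def sum_subtractf)
qed

end

section \<open>Splitting an auxiliary letter into functions of the state\<close>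

text \<open>For each state an input is drawn from its conditional law, independently over the
  states; \<open>\<pi>\<close> is the law of the resulting random function. As this function is
  independent of the state, every piece has a state mass proportional to that of
  \<open>\<mu>\<close>.\<close>

lemma exists_function_law:
  fixes \<mu> :: "'s::finite \<Rightarrow> 'x::finite \<Rightarrow> real"
  assumes \<mu>: "\<And>s x. \<mu> s x \<ge> 0"
  shows "\<exists>\<pi> :: ('s \<Rightarrow> 'x) \<Rightarrow> real. (\<forall>f. \<pi> f \<ge> 0) \<and> (\<Sum>f\<in>UNIV. \<pi> f) = 1 \<and>
    (\<forall>s x. \<mu> s x = (\<Sum>f\<in>UNIV. \<pi> f * graph_mass (\<lambda>s. \<Sum>x'\<in>UNIV. \<mu> s x') f s x))"
proof -
  define m where "m s = (\<Sum>x\<in>UNIV. \<mu> s x)" for s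
  \<comment> \<open>At states without mass any law would do; a point mass keeps the rows
    normalised.\<close>
  define \<kappa> where "\<kappa> s x = (if m s = 0 then if x = undefined then 1 else 0 else \<mu> s x / m s)" for s x
  define \<pi> where "\<pi> f = (\<Prod>s\<in>UNIV. \<kappa> s (f s))" for f
  have m: "m s \<ge> 0" for s using \<mu> by (simp add: m_def sum_nonneg)
  have \<kappa>: "\<kappa> s x \<ge> 0" for s x using \<mu> m by (simp add: \<kappa>_def)
  have \<kappa>1: "(\<Sum>x\<in>UNIV. \<kappa> s x) = 1" for s
    by (cases "m s = 0") (auto simp: \<kappa>_def m_def simp flip: sum_divide_distrib)
  have \<kappa>m: "m s * \<kappa> s x = \<mu> s x" for s x
  proof (cases "m s = 0")
    case True
    then have "\<mu> s x = 0" using \<mu> by (simp add: m_def sum_nonneg_eq_0_iff)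
    then show ?thesis using True by simp
  qed (simp add: \<kappa>_def)
  have PiE: "(\<Sum>f\<in>UNIV. \<Prod>s\<in>UNIV. h s (f s)) = (\<Prod>s\<in>UNIV. \<Sum>x\<in>UNIV. h s x)"
    for h :: "'s \<Rightarrow> 'x \<Rightarrow> real"
    by (subst prod_sum_PiE) (auto simp: PiE_UNIV_domain)
  have "(\<Sum>f\<in>UNIV. \<pi> f) = 1"
    unfolding \<pi>_def PiE by (simp add: \<kappa>1)
  moreover have "\<mu> s x = (\<Sum>f\<in>UNIV. \<pi> f * graph_mass m f s x)" for s x
  proof -
    \<comment> \<open>Zeroing the factor at \<open>s\<close> for inputs other than \<open>x\<close>
      puts the indicator of \<open>f s = x\<close> into the product, so the interchange
      \<open>PiE\<close> also computes the marginal of \<open>\<pi>\<close> at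
      \<open>s\<close>.\<close>
    define h where "h s' x' = (if s' = s \<and> x' \<noteq> x then 0 else \<kappa> s' x')" for s' x'
    have h: "(\<Prod>s'\<in>UNIV. h s' (f s')) = \<pi> f * (if f s = x then 1 else 0)" for f
    proof (cases "f s = x")
      case True
      then show ?thesis by (auto simp: \<pi>_def h_def intro!: prod.cong)
    next
      case False
      then have "h s (f s) = 0" by (simp add: h_def)
      then show ?thesis using False by (auto intro!: prod_zero)
    qed
    have "(\<Sum>f\<in>UNIV. \<pi> f * (if f s = x then 1 else 0)) = (\<Prod>s'\<in>UNIV. \<Sum>x'\<in>UNIV. h s' x')"
      by (simp only: PiE flip: h)
    also have "\<dots> = (\<Sum>x'\<in>UNIV. h s x') * (\<Prod>s'\<in>UNIV - {s}. \<Sum>x'\<in>UNIV. h s' x')"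
      by (subst prod.remove[of _ s]) auto
    also have "(\<Prod>s'\<in>UNIV - {s}. \<Sum>x'\<in>UNIV. h s' x') = 1"
      by (intro prod.neutral) (auto simp: h_def \<kappa>1)
    also have "(\<Sum>x'\<in>UNIV. h s x') = (\<Sum>x'\<in>UNIV. if x' = x then \<kappa> s x else 0)"
      by (intro sum.cong) (auto simp: h_def)
    finally have *: "(\<Sum>f\<in>UNIV. \<pi> f * (if f s = x then 1 else 0)) = \<kappa> s x" by simp
    have "(\<Sum>f\<in>UNIV. \<pi> f * graph_mass m f s x) = (\<Sum>f\<in>UNIV. m s * (\<pi> f * (if f s = x then 1 else 0)))"
      by (intro sum.cong) (auto simp: graph_mass_def)
    also have "\<dots> = m s * \<kappa> s x" unfolding sum_distrib_left[symmetric] * ..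
    finally show ?thesis by (simp add: \<kappa>m)
  qed
  moreover have "\<forall>f. \<pi> f \<ge> 0" by (simp add: \<pi>_def \<kappa> prod_nonneg)
  ultimately show ?thesis unfolding m_def by blast
qed

text \<open>Revealing the random function besides U keeps H(S|U), as the function is independent of
  the state given U, and can only lower H(Y|U).\<close>

lemma (in channel) entropy_gap_le_functions:
  assumes \<mu>: "\<And>s x. \<mu> s x \<ge> 0" and \<pi>: "\<And>f. \<pi> f \<ge> 0" "(\<Sum>f\<in>UNIV. \<pi> f) = 1"
    and rep: "\<And>s x. \<mu> s x = (\<Sum>f\<in>UNIV. \<pi> f * graph_mass (\<lambda>s. \<Sum>x'\<in>UNIV. \<mu> s x') f s x)"
  shows "entropy_gap W \<mu> \<le> (\<Sum>f\<in>UNIV. \<pi> f * entropy_gap W (graph_mass (\<lambda>s. \<Sum>x\<in>UNIV. \<mu> s x) f))"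
proof -
  define m where "m s = (\<Sum>x\<in>UNIV. \<mu> s x)" for s
  note rep' = rep[folded m_def]
  have m: "m s \<ge> 0" for s using \<mu> by (simp add: m_def sum_nonneg)
  have out: "out_mass W \<mu> y = (\<Sum>f\<in>UNIV. \<pi> f * out_mass W (graph_mass m f) y)" for y
  proof -
    have "out_mass W \<mu> y = out_mass W (\<lambda>s x. \<Sum>f\<in>UNIV. \<pi> f * graph_mass m f s x) y"
      by (rule arg_cong[of _ _ "\<lambda>\<mu>. out_mass W \<mu> y"]) (intro ext rep')
    then show ?thesis by (simp only: out_mass_def pairing_sum_left pairing_scale_left)
  qed
  have nn: "out_mass W (graph_mass m f) y \<ge> 0" for f y
    using m by (intro out_mass_nonneg) (simp add: graph_mass_def)
  have "(\<Sum>y\<in>UNIV. xlog (out_mass W \<mu> y))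
      \<le> (\<Sum>y\<in>UNIV. \<Sum>f\<in>UNIV. \<pi> f * xlog (out_mass W (graph_mass m f) y))"
    unfolding out by (intro sum_mono xlog_sum_le) (auto simp: \<pi> nn)
  also have "\<dots> = (\<Sum>f\<in>UNIV. \<pi> f * (\<Sum>y\<in>UNIV. xlog (out_mass W (graph_mass m f) y)))"
    by (subst sum.swap) (simp add: sum_distrib_left)
  finally have "entropy_gap W \<mu> \<le> \<dots> - (\<Sum>f\<in>UNIV. \<pi> f) * (\<Sum>s\<in>UNIV. xlog (m s))"
    by (simp add: entropy_gap_def \<pi> m_def)
  also have "\<dots> = (\<Sum>f\<in>UNIV. \<pi> f * entropy_gap W (graph_mass m f))"
    by (simp add: entropy_gap_def right_diff_distrib sum_subtractf sum_distrib_right)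
  finally show ?thesis by (simp add: m_def[abs_def])
qed

section \<open>Functionals fixed by a set of test functions\<close>

text \<open>The annihilator form of \<open>\<psi>\<close> lying in the linear span of
  \<open>\<Phi>\<close>: masses that agree on all test functions agree on \<open>\<psi>\<close>.
  Closure under sums and differences is immediate in this form.\<close>

definition determines :: "('s::finite \<Rightarrow> 'x::finite \<Rightarrow> real) set \<Rightarrow> ('s \<Rightarrow> 'x \<Rightarrow> real) \<Rightarrow> bool" where
  "determines \<Phi> \<psi> \<longleftrightarrow> (\<forall>\<nu>. (\<forall>\<phi>\<in>\<Phi>. pairing \<nu> \<phi> = 0) \<longrightarrow> pairing \<nu> \<psi> = 0)"

lemma determinesI: "\<psi> \<in> \<Phi> \<Longrightarrow> determines \<Phi> \<psi>"
  by (simp add: determines_def)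

lemma determinesD:
  "determines \<Phi> \<psi> \<Longrightarrow> (\<And>\<phi>. \<phi> \<in> \<Phi> \<Longrightarrow> pairing \<nu> \<phi> = 0) \<Longrightarrow> pairing \<nu> \<psi> = 0"
  by (simp add: determines_def)

lemma determines_sum: "(\<And>j. j \<in> J \<Longrightarrow> determines \<Phi> (\<psi> j)) \<Longrightarrow> determines \<Phi> (\<lambda>s x. \<Sum>j\<in>J. \<psi> j s x)"
  by (simp add: determines_def pairing_sum_right)

lemma determines_diff:
  "determines \<Phi> \<psi> \<Longrightarrow> determines \<Phi> \<psi>' \<Longrightarrow> determines \<Phi> (\<lambda>s x. \<psi> s x - \<psi>' s x)"
  by (simp add: determines_def pairing_diff_right)

text \<open>One output symbol needs no test function, as its column is 1 minus the others; this
  saves one constraint each for Y and Z.\<close>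

lemma determines_remaining:
  fixes V :: "'s::finite \<Rightarrow> 'x::finite \<Rightarrow> 'o::finite \<Rightarrow> real"
  assumes one: "determines \<Phi> (\<lambda>s x. 1)" and V: "\<And>s x. (\<Sum>o'\<in>UNIV. V s x o') = 1"
    and \<Phi>: "\<And>o'. o' \<noteq> out \<Longrightarrow> determines \<Phi> (\<lambda>s x. V s x o')"
  shows "determines \<Phi> (\<lambda>s x. V s x o')"
proof (cases "o' = out")
  case True
  have "(\<lambda>s x. V s x out) = (\<lambda>s x. 1 - (\<Sum>o'\<in>UNIV - {out}. V s x o'))"
  proof (intro ext)
    fix s x show "V s x out = 1 - (\<Sum>o'\<in>UNIV - {out}. V s x o')"
      using V[of s x] by (subst (asm) sum.remove[of _ out]) auto
  qed
  moreover have "determines \<Phi> \<dots>"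
    by (intro determines_diff one determines_sum \<Phi>) auto
  ultimately show ?thesis using True by simp
qed (simp add: \<Phi>)

text \<open>If the input alphabet is a singleton, the first term of the bound is not large enough for
  the marginal constraints, but there the joint law of \<open>(S, X)\<close> is fixed by only \<open>|S|\<close> numbers.\<close>

lemma (in channel) exists_test_functions:
  fixes b :: "'x \<Rightarrow> real"
  shows "\<exists>\<Phi>. finite \<Phi> \<and> card \<Phi> \<le> aux_bound TYPE('s) TYPE('x) TYPE('y) TYPE('z)
    \<and> (\<forall>s0. determines \<Phi> (\<lambda>s x. if s = s0 then 1 else 0))
    \<and> (\<forall>y. determines \<Phi> (\<lambda>s x. chanY W s x y)) \<and> (\<forall>z. determines \<Phi> (\<lambda>s x. chanZ W s x z))
    \<and> determines \<Phi> (\<lambda>s x. b x)"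
proof -
  have pos: "CARD('s) > 0" "CARD('x) > 0" "CARD('y) > 0" "CARD('z) > 0" by simp_all
  show ?thesis
  proof (cases "CARD('x) = 1 \<or> CARD('x) * CARD('s) \<le> CARD('x) + CARD('y) + CARD('z) + CARD('s) - 3")
    case True
    \<comment> \<open>Indicators of single state-input pairs fix the whole mass, at the price of |X|
      |S| test functions, the second term of the bound.\<close>
    define \<Phi> where "\<Phi> = range (\<lambda>(s0 :: 's, x0 :: 'x). \<lambda>s x. if s = s0 \<and> x = x0 then 1 else (0 :: real))"
    have "card \<Phi> \<le> CARD('s \<times> 'x)" unfolding \<Phi>_def by (rule card_image_le) simp
    also have "\<dots> = CARD('x) * CARD('s)" by simp
    \<comment> \<open>If |X| = 1, the first term is |Y| + |Z| + |S| - 2, which is at least |S|, so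
      the minimum is still the second term.\<close>
    also have "\<dots> \<le> aux_bound TYPE('s) TYPE('x) TYPE('y) TYPE('z)"
      using True pos unfolding aux_bound_def by (auto simp del: zero_less_card_finite)
    finally have "card \<Phi> \<le> aux_bound TYPE('s) TYPE('x) TYPE('y) TYPE('z)" .
    moreover have "determines \<Phi> \<psi>" for \<psi>
      unfolding determines_def
    proof (intro allI impI)
      fix \<nu> :: "'s \<Rightarrow> 'x \<Rightarrow> real" assume \<nu>: "\<forall>\<phi>\<in>\<Phi>. pairing \<nu> \<phi> = 0"
      have "\<nu> s0 x0 = 0" for s0 x0
      proof -
        have "pairing \<nu> (\<lambda>s x. if s = s0 \<and> x = x0 then 1 else 0) = 0"
          using \<nu> by (auto simp: \<Phi>_def)
        moreover have "(\<Sum>x\<in>UNIV. \<nu> s x * (if s = s0 \<and> x = x0 then 1 else 0))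
            = (if s = s0 then \<nu> s x0 else 0)" for s
          by (cases "s = s0") (auto simp: if_distrib[of "(*) _"] cong: if_cong)
        ultimately show ?thesis by (simp add: pairing_def)
      qed
      then show "pairing \<nu> \<psi> = 0" by (simp add: pairing_def)
    qed
    ultimately show ?thesis by (intro exI[of _ \<Phi>]) (auto simp: \<Phi>_def)
  next
    case False
    then have x2: "CARD('x) \<ge> 2" using pos by linarith
    define \<Phi>S where "\<Phi>S = range (\<lambda>(s0 :: 's) s (x :: 'x). if s = s0 then 1 else (0 :: real))"
    define \<Phi>Y where "\<Phi>Y = (\<lambda>y s x. chanY W s x y) ` (UNIV - {undefined})"
    define \<Phi>Z where "\<Phi>Z = (\<lambda>z s x. chanZ W s x z) ` (UNIV - {undefined})"
    define \<Phi> where "\<Phi> = \<Phi>S \<union> \<Phi>Y \<union> \<Phi>Z \<union> {\<lambda>s x. b x}"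
    have "card \<Phi>S \<le> CARD('s)" unfolding \<Phi>S_def by (rule card_image_le) simp
    moreover have "card \<Phi>Y \<le> CARD('y) - 1"
      unfolding \<Phi>Y_def by (rule order.trans[OF card_image_le]) (auto simp: card_Diff_subset)
    moreover have "card \<Phi>Z \<le> CARD('z) - 1"
      unfolding \<Phi>Z_def by (rule order.trans[OF card_image_le]) (auto simp: card_Diff_subset)
    moreover have "card \<Phi> \<le> card \<Phi>S + card \<Phi>Y + card \<Phi>Z + 1"
    proof -
      have "card {\<lambda>(s :: 's) x. b x} = 1" by simp
      then show ?thesis
        using card_Un_le[of "\<Phi>S \<union> \<Phi>Y \<union> \<Phi>Z" "{\<lambda>s x. b x}"] card_Un_le[of "\<Phi>S \<union> \<Phi>Y" \<Phi>Z]
          card_Un_le[of \<Phi>S \<Phi>Y]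
        unfolding \<Phi>_def by linarith
    qed
    \<comment> \<open>The total |S| + |Y| + |Z| - 1 is at most |X| + |Y| + |Z| + |S| - 3 exactly
      when |X| \<ge> 2.\<close>
    ultimately have "card \<Phi> \<le> CARD('s) + (CARD('y) - 1) + (CARD('z) - 1) + 1" by linarith
    then have "card \<Phi> \<le> aux_bound TYPE('s) TYPE('x) TYPE('y) TYPE('z)"
      using False x2 pos unfolding aux_bound_def by linarith
    moreover have S: "determines \<Phi> (\<lambda>s x. if s = s0 then 1 else 0)" for s0
      by (rule determinesI) (auto simp: \<Phi>_def \<Phi>S_def)
    have one: "determines \<Phi> (\<lambda>s x. 1)"
      using determines_sum[of UNIV \<Phi> "\<lambda>s0 s x. if s = s0 then 1 else 0"] S by simp
    have "determines \<Phi> (\<lambda>s x. chanY W s x y)" for y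
      by (rule determines_remaining[OF one, where V = "chanY W" and out = undefined])
         (auto simp: \<Phi>_def \<Phi>Y_def intro!: determinesI)
    moreover have "determines \<Phi> (\<lambda>s x. chanZ W s x z)" for z
      by (rule determines_remaining[OF one, where V = "chanZ W" and out = undefined])
         (auto simp: \<Phi>_def \<Phi>Z_def intro!: determinesI)
    moreover have "finite \<Phi>" by (simp add: \<Phi>_def \<Phi>S_def \<Phi>Y_def \<Phi>Z_def)
    moreover have "determines \<Phi> (\<lambda>s x. b x)"
      by (rule determinesI) (auto simp: \<Phi>_def)
    ultimately show ?thesis using S by (intro exI[of _ \<Phi>]) auto
  qed
qed

section \<open>Reduction of an arbitrary auxiliary to the allowed alphabet\<close>

context channel
begin

text \<open>Each \<open>c j\<close> is split separately, so an atom is a pair of an index and a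
  function. Atoms without mass are discarded, because the reduction to a basic solution uses the
  total mass as its positive functional.\<close>

lemma exists_function_decomposition:
  fixes c :: "'j \<Rightarrow> 's \<Rightarrow> 'x \<Rightarrow> real"
  assumes J: "finite J" and c: "\<forall>j\<in>J. \<forall>s x. c j s x \<ge> 0"
  shows "\<exists>(A :: ('j \<times> ('s \<Rightarrow> 'x)) set) q. finite A \<and> (\<forall>a s. q a s \<ge> 0)
    \<and> (\<forall>a\<in>A. (\<Sum>s\<in>UNIV. q a s) > 0)
    \<and> (\<forall>s x. (\<Sum>j\<in>J. c j s x) = (\<Sum>a\<in>A. graph_mass (q a) (snd a) s x))
    \<and> (\<Sum>j\<in>J. entropy_gap W (c j)) \<le> (\<Sum>a\<in>A. entropy_gap W (graph_mass (q a) (snd a)))"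
proof -
  define m where "m j s = (if j \<in> J then \<Sum>x\<in>UNIV. c j s x else 0)" for j s
  have m: "m j s \<ge> 0" for j s using c by (simp add: m_def sum_nonneg)
  have "\<forall>j\<in>J. \<exists>\<pi>. (\<forall>f. \<pi> f \<ge> 0) \<and> (\<Sum>f\<in>UNIV. \<pi> f) = 1 \<and>
      (\<forall>s x. c j s x = (\<Sum>f\<in>UNIV. \<pi> f * graph_mass (m j) f s x))"
  proof
    fix j assume "j \<in> J"
    then have "m j = (\<lambda>s. \<Sum>x\<in>UNIV. c j s x)" by (simp add: m_def[abs_def])
    then show "\<exists>\<pi>. (\<forall>f. \<pi> f \<ge> 0) \<and> (\<Sum>f\<in>UNIV. \<pi> f) = 1 \<and>
      (\<forall>s x. c j s x = (\<Sum>f\<in>UNIV. \<pi> f * graph_mass (m j) f s x))"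
      using exists_function_law[of "c j"] c \<open>j \<in> J\<close> by simp
  qed
  from bchoice[OF this] obtain \<pi>0 where \<pi>0: "\<forall>j\<in>J. (\<forall>f. \<pi>0 j f \<ge> 0) \<and> (\<Sum>f\<in>UNIV. \<pi>0 j f) = 1 \<and>
      (\<forall>s x. c j s x = (\<Sum>f\<in>UNIV. \<pi>0 j f * graph_mass (m j) f s x))" by blast
  define \<pi> where "\<pi> j f = (if j \<in> J then \<pi>0 j f else 0)" for j f
  have \<pi>: "\<pi> j f \<ge> 0" for j f using \<pi>0 by (simp add: \<pi>_def)
  define q where "q a s = \<pi> (fst a) (snd a) * m (fst a) s" for a :: "'j \<times> ('s \<Rightarrow> 'x)" and s
  have q: "q a s \<ge> 0" for a s using \<pi> m by (simp add: q_def)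
  define \<mu> where "\<mu> a = graph_mass (q a) (snd a)" for a
  define A where "A = {a \<in> J \<times> UNIV. (\<Sum>s\<in>UNIV. q a s) > 0}"
  have fin: "finite (J \<times> (UNIV :: ('s \<Rightarrow> 'x) set))" using J by simp
  have zero: "\<mu> a = (\<lambda>s x. 0)" if "a \<in> J \<times> UNIV - A" for a
  proof -
    have "(\<Sum>s\<in>UNIV. q a s) = 0"
      using that q sum_nonneg[of UNIV "q a"] by (auto simp: A_def not_less intro: antisym)
    then have "q a s = 0" for s using q by (simp add: sum_nonneg_eq_0_iff)
    then show ?thesis unfolding \<mu>_def by (intro ext) (simp add: graph_mass_def)
  qed
  have A_sum: "(\<Sum>a\<in>A. h (\<mu> a)) = (\<Sum>j\<in>J. \<Sum>f\<in>UNIV. h (\<mu> (j, f)))"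
    if "h (\<lambda>s x. 0) = 0" for h :: "('s \<Rightarrow> 'x \<Rightarrow> real) \<Rightarrow> real"
  proof -
    have "(\<Sum>a\<in>A. h (\<mu> a)) = (\<Sum>a\<in>J \<times> UNIV. h (\<mu> a))"
      using fin that zero by (intro sum.mono_neutral_left) (auto simp: A_def)
    then show ?thesis by (simp add: sum.cartesian_product)
  qed
  have \<mu>: "\<mu> (j, f) = (\<lambda>s x. \<pi> j f * graph_mass (m j) f s x)" for j f
    unfolding \<mu>_def q_def by (intro ext) (simp add: graph_mass_def)
  have "(\<Sum>j\<in>J. c j s x) = (\<Sum>a\<in>A. \<mu> a s x)" for s x
  proof -
    have "(\<Sum>j\<in>J. c j s x) = (\<Sum>j\<in>J. \<Sum>f\<in>UNIV. \<mu> (j, f) s x)"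
      using \<pi>0 by (intro sum.cong refl) (simp add: \<mu> \<pi>_def)
    then show ?thesis using A_sum[of "\<lambda>\<mu>. \<mu> s x"] by simp
  qed
  moreover have "(\<Sum>j\<in>J. entropy_gap W (c j)) \<le> (\<Sum>a\<in>A. entropy_gap W (\<mu> a))"
  proof -
    have "entropy_gap W (c j) \<le> (\<Sum>f\<in>UNIV. entropy_gap W (\<mu> (j, f)))" if j: "j \<in> J" for j
    proof -
      have mj: "m j = (\<lambda>s. \<Sum>x\<in>UNIV. c j s x)" using j by (simp add: m_def[abs_def])
      have "entropy_gap W (c j) \<le> (\<Sum>f\<in>UNIV. \<pi>0 j f * entropy_gap W (graph_mass (m j) f))"
        using entropy_gap_le_functions[of "c j" "\<pi>0 j"] c \<pi>0 j unfolding mj[symmetric] by blast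
      also have "\<dots> = (\<Sum>f\<in>UNIV. entropy_gap W (\<mu> (j, f)))"
        unfolding \<mu> using j \<pi> m
        \<pi>0 by (subst entropy_gap_scale) (auto simp: graph_mass_def \<pi>_def)
      finally show ?thesis .
    qed
    then have "(\<Sum>j\<in>J. entropy_gap W (c j)) \<le> (\<Sum>j\<in>J. \<Sum>f\<in>UNIV. entropy_gap W (\<mu> (j, f)))"
      by (rule sum_mono)
    also have "\<dots> = (\<Sum>a\<in>A. entropy_gap W (\<mu> a))"
      by (rule A_sum[symmetric]) (simp add: entropy_gap_def out_mass_def pairing_def)
    finally show ?thesis .
  qed
  moreover have "finite A" using fin by (simp add: A_def)
  ultimately show ?thesis
    using q by (intro exI[of _ A] exI[of _ q]) (auto simp: A_def \<mu>_def)
qed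

text \<open>Here \<open>c j s x\<close> is the joint mass of an auxiliary with arbitrary finite
  range, a state and an input. Reweighting the atoms preserves whatever the test functions
  determine, hence also H(Y) and H(S), so only the part of the objective that is linear in the
  weights changes.\<close>

lemma exists_small_auxiliary:
  fixes c :: "'j \<Rightarrow> 's \<Rightarrow> 'x \<Rightarrow> real" and b :: "'x \<Rightarrow> real"
  assumes J: "finite J" and c: "\<forall>j\<in>J. \<forall>s x. c j s x \<ge> 0"
    and PS: "\<And>s. (\<Sum>x\<in>UNIV. \<Sum>j\<in>J. c j s x) = PS s"
  defines "k \<equiv> aux_bound TYPE('s) TYPE('x) TYPE('y) TYPE('z)"
  shows "\<exists>PUS xf. (\<forall>s. is_pmf_on {0..<k} (PUS s))
    \<and> (\<forall>z. (\<Sum>s\<in>UNIV. \<Sum>u<k. PS s * PUS s u * chanZ W s (xf u s) z)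
          = pairing (\<lambda>s x. \<Sum>j\<in>J. c j s x) (\<lambda>s x. chanZ W s x z))
    \<and> (\<Sum>s\<in>UNIV. \<Sum>u<k. PS s * PUS s u * b (xf u s))
          = pairing (\<lambda>s x. \<Sum>j\<in>J. c j s x) (\<lambda>s x. b x)
    \<and> (\<Sum>j\<in>J. entropy_gap W (c j)) - (\<Sum>y\<in>UNIV. xlog (out_mass W (\<lambda>s x. \<Sum>j\<in>J. c j s x) y))
          + (\<Sum>s\<in>UNIV. xlog (PS s)) \<le> nc_objective PS W k PUS xf"
proof -
  define cs where "cs s x = (\<Sum>j\<in>J. c j s x)" for s x
  obtain A :: "('j \<times> ('s \<Rightarrow> 'x)) set" and q where fin: "finite A" and "\<forall>a s. q a s \<ge> 0"
    and "\<forall>a\<in>A. (\<Sum>s\<in>UNIV. q a s) > 0"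
    and "\<forall>s x. cs s x = (\<Sum>a\<in>A. graph_mass (q a) (snd a) s x)"
    and gap_A: "(\<Sum>j\<in>J. entropy_gap W (c j)) \<le> (\<Sum>a\<in>A. entropy_gap W (graph_mass (q a) (snd a)))"
    using exists_function_decomposition[OF J c, folded cs_def] by (elim exE conjE) (rule that)
  then have q: "q a s \<ge> 0" and mass: "a \<in> A \<Longrightarrow> (\<Sum>s\<in>UNIV. q a s) > 0"
    and sum_A: "cs s x = (\<Sum>a\<in>A. graph_mass (q a) (snd a) s x)" for a s x
    by blast+
  define \<mu> where "\<mu> a = graph_mass (q a) (snd a)" for a
  obtain \<Phi> :: "('s \<Rightarrow> 'x \<Rightarrow> real) set" where \<Phi>: "finite \<Phi>" "card \<Phi> \<le> k"
    and det': "\<forall>s0. determines \<Phi> (\<lambda>s x. if s = s0 then 1 else 0)"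
      "\<forall>y. determines \<Phi> (\<lambda>s x. chanY W s x y)" "\<forall>z. determines \<Phi> (\<lambda>s x. chanZ W s x z)"
      "determines \<Phi> (\<lambda>s x. b x)"
    using exists_test_functions[of b, folded k_def] by (elim exE conjE) (rule that)
  note det = det'(1-3)[rule_format] det'(4)
  have one: "determines \<Phi> (\<lambda>s x. 1)"
    using determines_sum[of UNIV \<Phi> "\<lambda>s0 s x. if s = s0 then 1 else 0"] det(1) by simp
  have cs_pair: "pairing cs \<phi> = (\<Sum>a\<in>A. pairing (\<mu> a) \<phi>)" for \<phi>
  proof -
    have "cs = (\<lambda>s x. \<Sum>a\<in>A. \<mu> a s x)" by (intro ext) (simp add: sum_A \<mu>_def)
    then show ?thesis by (simp only: pairing_sum_left)
  qed
  \<comment> \<open>The given masses are the feasible point with all weights 1. The total mass is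
    positive on each atom and is fixed by the state constraints.\<close>
  have "\<exists>K v. K \<subseteq> A \<and> card K \<le> card \<Phi> \<and> (\<forall>a\<in>K. v a \<ge> 0)
    \<and> (\<forall>\<phi>\<in>\<Phi>. (\<Sum>a\<in>K. v a * pairing (\<mu> a) \<phi>) = (\<Sum>a\<in>A. 1 * pairing (\<mu> a) \<phi>))
    \<and> (\<Sum>a\<in>A. 1 * entropy_gap W (\<mu> a)) \<le> (\<Sum>a\<in>K. v a * entropy_gap W (\<mu> a))"
  proof (rule basic_feasible_solution[where m = "\<lambda>a. pairing (\<mu> a) (\<lambda>s x. 1)"])
    show "pairing (\<mu> a) (\<lambda>s x. 1) > 0" if "a \<in> A" for a
      using mass[OF that] by (simp add: \<mu>_def)
    show "(\<Sum>a\<in>A. r a * pairing (\<mu> a) (\<lambda>s x. 1)) = 0"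
      if "\<And>\<phi>. \<phi> \<in> \<Phi> \<Longrightarrow> (\<Sum>a\<in>A. r a * pairing (\<mu> a) \<phi>) = 0" for r
    proof -
      have "pairing (\<lambda>s x. \<Sum>a\<in>A. r a * \<mu> a s x) (\<lambda>s x. 1) = 0"
        by (rule determinesD[OF one]) (simp only: pairing_sum_left pairing_scale_left that)
      then show ?thesis by (simp only: pairing_sum_left pairing_scale_left)
    qed
  qed (use \<Phi> fin in auto)
  from this[unfolded mult_1, folded cs_pair] obtain K v where K: "K \<subseteq> A" "card K \<le> card \<Phi>" and v': "\<forall>a\<in>K. v a \<ge> 0"
    and eq': "\<forall>\<phi>\<in>\<Phi>. (\<Sum>a\<in>K. v a * pairing (\<mu> a) \<phi>) = pairing cs \<phi>"
    and gap_K: "(\<Sum>a\<in>A. entropy_gap W (\<mu> a)) \<le> (\<Sum>a\<in>K. v a * entropy_gap W (\<mu> a))"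
    by (elim exE conjE) (rule that)
  note v = bspec[OF v'] and eq = bspec[OF eq']
  have eq_det: "(\<Sum>a\<in>K. v a * pairing (\<mu> a) \<psi>) = pairing cs \<psi>" if "determines \<Phi> \<psi>" for \<psi>
  proof -
    have "pairing (\<lambda>s x. (\<Sum>a\<in>K. v a * \<mu> a s x) - cs s x) \<psi> = 0"
      by (rule determinesD[OF that]) (simp add: pairing_diff_left pairing_sum_left pairing_scale_left eq)
    then show ?thesis by (simp add: pairing_diff_left pairing_sum_left pairing_scale_left)
  qed
  have finK: "finite K" using K fin finite_subset by blast
  then obtain e where e: "bij_betw e {0..<card K} K" using ex_bij_betw_nat_finite by blast
  \<comment> \<open>Letters from \<open>card K\<close> up to \<open>k\<close> get mass 0, so the
    alphabet has \<open>k\<close> letters whatever the size of \<open>K\<close>; the later limit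
    needs this fixed size.\<close>
  define R where "R u s = (if u < card K then v (e u) * q (e u) s else 0)" for u s
  define xf where "xf u = snd (e u)" for u
  have eK: "e u \<in> K" if "u < card K" for u using bij_betwE[OF e] that by simp
  have R: "R u s \<ge> 0" for u s using v eK q by (simp add: R_def)
  have sum_K: "(\<Sum>u<k. h u) = (\<Sum>a\<in>K. g a)"
    if "\<And>u. u < card K \<Longrightarrow> h u = g (e u)" "\<And>u. u \<ge> card K \<Longrightarrow> h u = 0" for h g :: "_ \<Rightarrow> real"
  proof -
    have "(\<Sum>a\<in>K. g a) = (\<Sum>u\<in>{0..<card K}. g (e u))"
      using e by (rule sum.reindex_bij_betw[symmetric])
    also have "\<dots> = (\<Sum>u\<in>{0..<card K}. h u)" using that by (intro sum.cong) auto
    also have "\<dots> = (\<Sum>u<k. h u)"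
      using K(2) \<Phi>(2) that(2) by (intro sum.mono_neutral_left) auto
    finally show ?thesis by simp
  qed
  have sum_R: "(\<Sum>u<k. \<Sum>s\<in>UNIV. R u s * \<phi> s (xf u s)) = pairing cs \<phi>" if "determines \<Phi> \<phi>" for \<phi>
  proof -
    have "(\<Sum>u<k. \<Sum>s\<in>UNIV. R u s * \<phi> s (xf u s)) = (\<Sum>a\<in>K. v a * pairing (\<mu> a) \<phi>)"
      by (rule sum_K) (auto simp: R_def \<mu>_def xf_def sum_distrib_left mult.assoc)
    then show ?thesis using eq_det[OF that] by simp
  qed
  have R_PS: "(\<Sum>u<k. R u s0) = PS s0" for s0
  proof -
    have "(\<Sum>u<k. \<Sum>s\<in>UNIV. R u s * (if s = s0 then 1 else 0)) = (\<Sum>x\<in>UNIV. cs s0 x)"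
      using sum_R[OF det(1)] by (simp add: pairing_state)
    also have "\<dots> = PS s0" by (simp add: cs_def PS)
    also have "(\<Sum>u<k. \<Sum>s\<in>UNIV. R u s * (if s = s0 then 1 else 0)) = (\<Sum>u<k. R u s0)"
      by (simp add: if_distrib[of "(*) _"] cong: if_cong)
    finally show ?thesis .
  qed
  have PS0: "PS s \<ge> 0" for s using R R_PS[of s] sum_nonneg[of "{..<k}" "\<lambda>u. R u s"] by simp
  \<comment> \<open>At states of probability 0 the conditional law is arbitrary; it is put on letter
    0, which exists since \<open>k > 0\<close>.\<close>
  define PUS where "PUS s u = (if PS s = 0 then if u = 0 then 1 else 0 else R u s / PS s)" for s u
  have kpos: "k > 0"
  proof -
    have "CARD('s) > 0" "CARD('x) > 0" "CARD('y) > 0" "CARD('z) > 0" by simp_all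
    then have "CARD('x) + CARD('y) + CARD('z) + CARD('s) - 3 > 0" by linarith
    then show ?thesis by (simp add: k_def aux_bound_def)
  qed
  have PUS_R: "PS s * PUS s u = R u s" if "u < k" for s u
  proof (cases "PS s = 0")
    case True
    then have "(\<Sum>u<k. R u s) = 0" using R_PS[of s] by simp
    then have "R u s = 0" using R that by (simp add: sum_nonneg_eq_0_iff)
    then show ?thesis using True by simp
  qed (simp add: PUS_def)
  have "is_pmf_on {0..<k} (PUS s)" for s
  proof (cases "PS s = 0")
    case True
    then show ?thesis using kpos by (simp add: is_pmf_on_def PUS_def)
  next
    case False
    then show ?thesis using R PS0 R_PS[of s]
      by (simp add: is_pmf_on_def PUS_def atLeast0LessThan flip: sum_divide_distrib)
  qed
  moreover have sum_PUS: "(\<Sum>s\<in>UNIV. \<Sum>u<k. PS s * PUS s u * \<phi> s (xf u s)) = pairing cs \<phi>"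
    if "determines \<Phi> \<phi>" for \<phi>
    unfolding sum_R[OF that, symmetric] by (subst sum.swap) (simp add: PUS_R)
  moreover have "(\<Sum>j\<in>J. entropy_gap W (c j)) - (\<Sum>y\<in>UNIV. xlog (out_mass W cs y))
      + (\<Sum>s\<in>UNIV. xlog (PS s)) \<le> nc_objective PS W k PUS xf"
  proof -
    have "(\<Sum>u<k. entropy_gap W (graph_mass (R u) (xf u))) = (\<Sum>a\<in>K. v a * entropy_gap W (\<mu> a))"
    proof (rule sum_K)
      have \<mu>0: "\<mu> a s x \<ge> 0" for a s x using q by (simp add: \<mu>_def graph_mass_def)
      fix u assume u: "u < card K"
      have "graph_mass (R u) (xf u) = (\<lambda>s x. v (e u) * \<mu> (e u) s x)"
        using u by (intro ext) (simp add: graph_mass_def R_def xf_def \<mu>_def)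
      then show "entropy_gap W (graph_mass (R u) (xf u)) = v (e u) * entropy_gap W (\<mu> (e u))"
        using v[OF eK[OF u]] \<mu>0 by (simp add: entropy_gap_scale)
    next
      fix u assume "u \<ge> card K"
      then have "graph_mass (R u) (xf u) = (\<lambda>s x. 0)" by (intro ext) (simp add: graph_mass_def R_def)
      then show "entropy_gap W (graph_mass (R u) (xf u)) = 0"
        by (simp add: entropy_gap_def out_mass_def pairing_def)
    qed
    then have "(\<Sum>j\<in>J. entropy_gap W (c j)) \<le> (\<Sum>u<k. entropy_gap W (graph_mass (R u) (xf u)))"
      using gap_A gap_K by (simp add: \<mu>_def)
    moreover have "(\<Sum>u<k. \<Sum>s\<in>UNIV. R u s * chanY W s (xf u s) y) = out_mass W cs y" for y
      using sum_R[OF det(2)] by (simp add: out_mass_def)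
    ultimately show ?thesis
      by (subst nc_objective_eq_entropy_gap[of k PS PUS R]) (auto simp: PUS_R R R_PS)
  qed
  ultimately show ?thesis
    using sum_PUS[OF det(3)] sum_PUS[OF det(4)] unfolding cs_def[abs_def, symmetric]
    by (intro exI[of _ PUS] exI[of _ xf] conjI allI) simp_all
qed

end

subsection \<open>Block codes\<close>

lemma log2_prod:
  assumes "\<And>i. i \<in> I \<Longrightarrow> f i > 0"
  shows "log 2 (\<Prod>i\<in>I. f i) = (\<Sum>i\<in>I. log 2 (f i))"
  using assms
proof (induction I rule: infinite_finite_induct)
  case (insert i I)
  then have "(\<Prod>i\<in>I. f i) > 0" by (intro prod_pos) auto
  then show ?case using insert by (simp add: log_mult_pos)
qed auto

lemma sum_seq_prob:
  fixes P :: "'a::finite \<Rightarrow> real"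
  assumes "(\<Sum>a\<in>UNIV. P a) = 1"
  shows "(\<Sum>xs\<in>seqs n. seq_prob P xs) = 1"
proof -
  have "(\<Sum>xs\<in>seqs n. seq_prob P xs) = (\<Sum>xs\<in>seqs n. \<Prod>i<n. P (xs ! i))"
    by (intro sum.cong refl) (simp add: seqs_def seq_prob_def)
  then show ?thesis by (simp add: sum_seqs_prod[of "\<lambda>_. P"] assms)
qed

lemma sum_seq_prob_coordinate:
  fixes P :: "'a::finite \<Rightarrow> real"
  assumes "(\<Sum>a\<in>UNIV. P a) = 1" "i < n"
  shows "(\<Sum>xs\<in>seqs n. seq_prob P xs * (if xs ! i = b then 1 else 0)) = P b"
proof -
  have "(\<Sum>xs\<in>seqs n. seq_prob P xs * (if xs ! i = b then 1 else 0))
      = (\<Sum>xs\<in>seqs n. (\<Prod>i<n. P (xs ! i)) * 1 * (if xs ! i = b then 1 else 0))"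
    by (intro sum.cong refl) (simp add: seqs_def seq_prob_def)
  also have "\<dots> = P b"
    using assms by (subst sum_seqs_coordinate) (simp_all add: sum_seqs_prod[of "\<lambda>_. P"])
  finally show ?thesis .
qed

lemma sum_chan_prod:
  fixes V :: "'s \<Rightarrow> 'x \<Rightarrow> 'o::finite \<Rightarrow> real"
  assumes "\<And>s x. (\<Sum>a\<in>UNIV. V s x a) = 1" "s \<in> seqs n"
  shows "(\<Sum>ys\<in>seqs n. chan_prod V s x ys) = 1"
proof -
  have "length s = n" using assms by (simp add: seqs_def)
  then show ?thesis
    using sum_seqs_prod[where n = n and V = "\<lambda>i. V (s ! i) (x ! i)"] assms by (simp add: chan_prod_def)
qed

lemma sum_chan_prod_coordinate:
  fixes V :: "'s \<Rightarrow> 'x \<Rightarrow> 'o::finite \<Rightarrow> real"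
  assumes "\<And>s x. (\<Sum>a\<in>UNIV. V s x a) = 1" "s \<in> seqs n" "i < n"
    and F: "\<And>ys a. ys \<in> seqs n \<Longrightarrow> F (ys[i := a]) = F ys"
  shows "(\<Sum>ys\<in>seqs n. chan_prod V s x ys * F ys * (if ys ! i = b then 1 else 0))
    = V (s ! i) (x ! i) b * (\<Sum>ys\<in>seqs n. chan_prod V s x ys * F ys)"
proof -
  have "length s = n" using assms by (simp add: seqs_def)
  then show ?thesis
    using sum_seqs_coordinate[of i n "\<lambda>i. V (s ! i) (x ! i)" F b] assms by (simp add: chan_prod_def)
qed

locale nc_code = channel W
  for W :: "'s::finite \<Rightarrow> 'x::finite \<Rightarrow> 'y::finite \<Rightarrow> 'z::finite \<Rightarrow> real" +
  fixes PS :: "'s \<Rightarrow> real" and n NM NK :: nat and enc :: "nat \<Rightarrow> nat \<Rightarrow> 's list \<Rightarrow> 'x list \<Rightarrow> real"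
  assumes PS: "is_pmf_on UNIV PS" and n: "n > 0" and NM: "NM > 0" and NK: "NK > 0"
    and enc: "nc_encoder n NM NK enc"
begin

lemma PS_nonneg [simp]: "PS s \<ge> 0" and sum_PS [simp]: "(\<Sum>s\<in>UNIV. PS s) = 1"
  using PS by (auto simp: is_pmf_on_def)

lemma seq_prob_nonneg [simp]: "seq_prob PS s \<ge> 0"
  by (simp add: seq_prob_def prod_nonneg)

lemma chan_prod_nonneg [simp]: "chan_prod (chanY W) s x y \<ge> 0" "chan_prod (chanZ W) s x z \<ge> 0"
  by (simp_all add: chan_prod_def prod_nonneg)

abbreviation cw where "cw \<equiv> code_weight NM NK PS enc"

lemma cw_nonneg: "m < NM \<Longrightarrow> k < NK \<Longrightarrow> s \<in> seqs n \<Longrightarrow> x \<in> seqs n \<Longrightarrow> cw m k s x \<ge> 0"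
  using enc by (simp add: code_weight_def nc_encoder_def is_pmf_on_def)

lemma sum_cw:
  assumes "m < NM" "k < NK" "s \<in> seqs n"
  shows "(\<Sum>x\<in>seqs n. cw m k s x) = seq_prob PS s / (real NM * real NK)"
proof -
  have "(\<Sum>x\<in>seqs n. enc m k s x) = 1" using enc assms by (simp add: nc_encoder_def is_pmf_on_def)
  then show ?thesis by (simp add: code_weight_def flip: sum_distrib_left sum_divide_distrib)
qed

section \<open>The probability space of a code\<close>

text \<open>The warden's output is left out: its law follows from states and inputs by averaging
  \<open>chanZ\<close>.\<close>

definition \<Omega> :: "(nat \<times> nat \<times> 's list \<times> 'x list \<times> 'y list) set" where
  "\<Omega> = {..<NM} \<times> {..<NK} \<times> seqs n \<times> seqs n \<times> seqs n"

definition p :: "nat \<times> nat \<times> 's list \<times> 'x list \<times> 'y list \<Rightarrow> real" where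
  "p = (\<lambda>(m, k, s, x, y). cw m k s x * chan_prod (chanY W) s x y)"

definition ex :: "(nat \<times> nat \<times> 's list \<times> 'x list \<times> 'y list \<Rightarrow> real) \<Rightarrow> real" where
  "ex h = (\<Sum>\<omega>\<in>\<Omega>. p \<omega> * h \<omega>)"

lemma finite_\<Omega> [simp]: "finite \<Omega>"
  by (simp add: \<Omega>_def)

lemma ex_eq: "ex h = (\<Sum>m<NM. \<Sum>k<NK. \<Sum>s\<in>seqs n. \<Sum>x\<in>seqs n. \<Sum>y\<in>seqs n.
    cw m k s x * chan_prod (chanY W) s x y * h (m, k, s, x, y))"
  by (simp add: ex_def \<Omega>_def p_def sum.cartesian_product split_beta)

lemma ex_cong: "(\<And>\<omega>. \<omega> \<in> \<Omega> \<Longrightarrow> h \<omega> = h' \<omega>) \<Longrightarrow> ex h = ex h'"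
  by (simp add: ex_def)

lemma p_nonneg: "\<omega> \<in> \<Omega> \<Longrightarrow> p \<omega> \<ge> 0"
  by (auto simp: \<Omega>_def p_def cw_nonneg)

lemma ex_no_output: "ex (\<lambda>(m, k, s, x, y). h m k s x)
    = (\<Sum>m<NM. \<Sum>k<NK. \<Sum>s\<in>seqs n. \<Sum>x\<in>seqs n. cw m k s x * h m k s x)"
proof -
  have "(\<Sum>y\<in>seqs n. cw m k s x * chan_prod (chanY W) s x y * h m k s x) = cw m k s x * h m k s x"
    if "s \<in> seqs n" for m k s x
    using sum_chan_prod[of "chanY W" s n x] that by (simp flip: sum_distrib_left sum_distrib_right)
  then show ?thesis by (simp add: ex_eq)
qed

lemma ex_state: "ex (\<lambda>(m, k, s, x, y). h m k s)
    = (\<Sum>m<NM. \<Sum>k<NK. \<Sum>s\<in>seqs n. seq_prob PS s / (real NM * real NK) * h m k s)"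
  unfolding ex_no_output by (intro sum.cong refl) (simp add: sum_cw flip: sum_distrib_right)

lemma ex_state_only: "ex (\<lambda>(m, k, s, x, y). h s) = (\<Sum>s\<in>seqs n. seq_prob PS s * h s)"
proof -
  have "ex (\<lambda>(m, k, s, x, y). h s)
      = real NM * (real NK * (\<Sum>s\<in>seqs n. seq_prob PS s * h s / (real NM * real NK)))"
    unfolding ex_state by simp
  also have "\<dots> = (\<Sum>s\<in>seqs n. seq_prob PS s * h s)"
    using NM NK by (simp flip: sum_divide_distrib)
  finally show ?thesis .
qed

lemma ex_one: "ex (\<lambda>_. 1) = 1"
proof -
  have "ex (\<lambda>_. 1) = ex (\<lambda>(m, k, s, x, y). 1)" by (rule ex_cong) auto
  then show ?thesis using ex_state_only[of "\<lambda>_. 1"] by (simp add: sum_seq_prob)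
qed

lemma sum_p: "(\<Sum>\<omega>\<in>\<Omega>. p \<omega>) = 1"
  using ex_one by (simp add: ex_def)

lemma ex_add: "ex (\<lambda>\<omega>. g \<omega> + h \<omega>) = ex g + ex h"
  by (simp add: ex_def distrib_left sum.distrib)

lemma ex_diff: "ex (\<lambda>\<omega>. g \<omega> - h \<omega>) = ex g - ex h"
  by (simp add: ex_def right_diff_distrib sum_subtractf)

lemma ex_scale: "ex (\<lambda>\<omega>. h \<omega> * t) = ex h * t"
  by (simp add: ex_def sum_distrib_right mult.assoc)

lemma ex_const: "ex (\<lambda>_. t) = t"
  using ex_scale[of "\<lambda>_. 1" t] ex_one by simp

lemma ex_sum: "ex (\<lambda>\<omega>. \<Sum>i\<in>I. h i \<omega>) = (\<Sum>i\<in>I. ex (h i))"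
  unfolding ex_def by (subst sum.swap) (simp add: sum_distrib_left)

lemma ex_nonneg: "(\<And>\<omega>. \<omega> \<in> \<Omega> \<Longrightarrow> h \<omega> \<ge> 0) \<Longrightarrow> ex h \<ge> 0"
  by (simp add: ex_def p_nonneg sum_nonneg)

lemma pr_eq_ex: "pr \<Omega> p f v = ex (\<lambda>\<omega>. if f \<omega> = v then 1 else 0)"
  by (simp add: pr_def ex_def)

text \<open>Memorylessness: given states and inputs, output \<open>i\<close> has law
  \<open>chanY\<close> and is independent of anything that does not read it.\<close>

lemma ex_output_coordinate:
  assumes i: "i < n" and h: "\<And>m k s x y a. y \<in> seqs n \<Longrightarrow> h m k s x (y[i := a]) = h m k s x y"
  shows "ex (\<lambda>(m, k, s, x, y). h m k s x y * (if y ! i = b then 1 else 0))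
    = ex (\<lambda>(m, k, s, x, y). h m k s x y * chanY W (s ! i) (x ! i) b)"
proof -
  have "(\<Sum>y\<in>seqs n. cw m k s x * chan_prod (chanY W) s x y * (h m k s x y * (if y ! i = b then 1 else 0)))
      = (\<Sum>y\<in>seqs n. cw m k s x * chan_prod (chanY W) s x y * (h m k s x y * chanY W (s ! i) (x ! i) b))"
    if s: "s \<in> seqs n" for m k s x
  proof -
    have "(\<Sum>y\<in>seqs n. cw m k s x * chan_prod (chanY W) s x y * (h m k s x y * (if y ! i = b then 1 else 0)))
      = cw m k s x * (\<Sum>y\<in>seqs n. chan_prod (chanY W) s x y * h m k s x y * (if y ! i = b then 1 else 0))"
      by (simp only: sum_distrib_left mult.assoc)
    also have "\<dots> = cw m k s x * (chanY W (s ! i) (x ! i) b * (\<Sum>y\<in>seqs n. chan_prod (chanY W) s x y * h m k s x y))"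
      using i s h by (subst sum_chan_prod_coordinate) auto
    also have "\<dots> = (\<Sum>y\<in>seqs n. cw m k s x * chan_prod (chanY W) s x y * (h m k s x y * chanY W (s ! i) (x ! i) b))"
      by (simp add: sum_distrib_left mult_ac)
    finally show ?thesis .
  qed
  then show ?thesis by (simp add: ex_eq)
qed

section \<open>The auxiliary variable and its telescoping sum\<close>

definition aux :: "nat \<Rightarrow> nat \<times> nat \<times> 's list \<times> 'x list \<times> 'y list \<Rightarrow> nat \<times> nat \<times> 'y list \<times> 's list" where
  "aux i = (\<lambda>(m, k, s, x, y). (m, k, take i y, drop (Suc i) s))"

text \<open>Adjoining \<open>S\<^sub>i\<close> to \<open>aux i\<close> gives \<open>hybrid i\<close>, adjoining \<open>Y\<^sub>i\<close> gives \<open>hybrid (i + 1)\<close>; this is what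
  makes the sum over \<open>i\<close> telescope. Positions are counted from 0.\<close>

definition hybrid :: "nat \<Rightarrow> nat \<times> nat \<times> 's list \<times> 'x list \<times> 'y list \<Rightarrow> nat \<times> nat \<times> 'y list \<times> 's list" where
  "hybrid i = (\<lambda>(m, k, s, x, y). (m, k, take i y, drop i s))"

definition st :: "nat \<Rightarrow> nat \<times> nat \<times> 's list \<times> 'x list \<times> 'y list \<Rightarrow> 's" where
  "st i = (\<lambda>(m, k, s, x, y). s ! i)"

definition inp :: "nat \<Rightarrow> nat \<times> nat \<times> 's list \<times> 'x list \<times> 'y list \<Rightarrow> 'x" where
  "inp i = (\<lambda>(m, k, s, x, y). x ! i)"

definition outp :: "nat \<Rightarrow> nat \<times> nat \<times> 's list \<times> 'x list \<times> 'y list \<Rightarrow> 'y" where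
  "outp i = (\<lambda>(m, k, s, x, y). y ! i)"

definition joint where
  "joint i v s x = ex (\<lambda>\<omega>. if aux i \<omega> = v \<and> st i \<omega> = s \<and> inp i \<omega> = x then 1 else 0)"

lemma joint_nonneg: "joint i v s x \<ge> 0"
  by (simp add: joint_def ex_nonneg)

lemma pairing_joint:
  "pairing (joint i v) \<phi> = ex (\<lambda>\<omega>. (if aux i \<omega> = v then 1 else 0) * \<phi> (st i \<omega>) (inp i \<omega>))"
proof -
  have "pairing (joint i v) \<phi> = ex (\<lambda>\<omega>. \<Sum>s\<in>UNIV. \<Sum>x\<in>UNIV.
      (if aux i \<omega> = v \<and> st i \<omega> = s \<and> inp i \<omega> = x then 1 else 0) * \<phi> s x)"
    by (simp only: pairing_def joint_def ex_sum ex_scale)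
  also have "\<dots> = ex (\<lambda>\<omega>. (if aux i \<omega> = v then 1 else 0) * \<phi> (st i \<omega>) (inp i \<omega>))"
  proof (rule ex_cong)
    fix \<omega>
    have "(\<Sum>x\<in>UNIV. (if aux i \<omega> = v \<and> st i \<omega> = s \<and> inp i \<omega> = x then 1 else 0) * \<phi> s x)
        = (if st i \<omega> = s then (if aux i \<omega> = v then 1 else 0) * \<phi> s (inp i \<omega>) else 0)" for s
      by (simp add: if_distrib[of "\<lambda>t. t * _"] cong: if_cong)
    then show "(\<Sum>s\<in>UNIV. \<Sum>x\<in>UNIV. (if aux i \<omega> = v \<and> st i \<omega> = s \<and> inp i \<omega> = x then 1 else 0) * \<phi> s x)
        = (if aux i \<omega> = v then 1 else 0) * \<phi> (st i \<omega>) (inp i \<omega>)"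
      by simp
  qed
  finally show ?thesis .
qed

lemma sum_joint_input: "(\<Sum>x\<in>UNIV. joint i v s x) = pr \<Omega> p (\<lambda>\<omega>. (aux i \<omega>, st i \<omega>)) (v, s)"
  unfolding pairing_state[symmetric] pairing_joint pr_eq_ex by (rule ex_cong) auto

text \<open>The Markov chain V_i - (S_i, X_i) - Y_i: sending the joint mass through the channel
  gives back the true law of (V_i, Y_i), because \<open>aux i\<close> reads only outputs before
  position \<open>i\<close>.\<close>

lemma out_mass_joint:
  assumes i: "i < n"
  shows "out_mass W (joint i v) y = pr \<Omega> p (\<lambda>\<omega>. (aux i \<omega>, outp i \<omega>)) (v, y)"
proof -
  define h where "h m k s x y = (if (m, k, take i y, drop (Suc i) s) = v then 1 else (0 :: real))"
    for m k s and x :: "'x list" and y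
  have "out_mass W (joint i v) y = ex (\<lambda>(m, k, s, x, y'). h m k s x y' * chanY W (s ! i) (x ! i) y)"
    unfolding out_mass_def pairing_joint by (rule ex_cong) (auto simp: aux_def st_def inp_def h_def)
  also have "\<dots> = ex (\<lambda>(m, k, s, x, y'). h m k s x y' * (if y' ! i = y then 1 else 0))"
    by (rule ex_output_coordinate[symmetric]) (use i in \<open>auto simp: h_def\<close>)
  also have "\<dots> = pr \<Omega> p (\<lambda>\<omega>. (aux i \<omega>, outp i \<omega>)) (v, y)"
    unfolding pr_eq_ex by (rule ex_cong) (auto simp: aux_def outp_def h_def)
  finally show ?thesis .
qed

lemma sum_entropy_gap_joint:
  assumes i: "i < n"
  shows "(\<Sum>v\<in>aux i ` \<Omega>. entropy_gap W (joint i v)) = ent \<Omega> p (hybrid i) - ent \<Omega> p (hybrid (Suc i))"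
proof -
  have 1: "ent \<Omega> p (\<lambda>\<omega>. (aux i \<omega>, st i \<omega>)) = - (\<Sum>v\<in>aux i ` \<Omega>. \<Sum>s\<in>UNIV. xlog (\<Sum>x\<in>UNIV. joint i v s x))"
    by (subst ent_eq_sum_xlog[where A = "aux i ` \<Omega> \<times> UNIV"]) (auto simp: sum_joint_input sum.cartesian_product)
  have 2: "ent \<Omega> p (\<lambda>\<omega>. (aux i \<omega>, outp i \<omega>)) = - (\<Sum>v\<in>aux i ` \<Omega>. \<Sum>y\<in>UNIV. xlog (out_mass W (joint i v) y))"
    by (subst ent_eq_sum_xlog[where A = "aux i ` \<Omega> \<times> UNIV"]) (auto simp: out_mass_joint[OF i] sum.cartesian_product)
  have "ent \<Omega> p (\<lambda>\<omega>. (aux i \<omega>, st i \<omega>)) = ent \<Omega> p (hybrid i)"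
  proof (rule ent_cong_kernel)
    fix \<omega> \<omega>' assume "\<omega> \<in> \<Omega>" "\<omega>' \<in> \<Omega>"
    moreover have "drop i s = s ! i # drop (Suc i) s" if "s \<in> seqs n" for s :: "'s list"
      using that i by (simp add: seqs_def Cons_nth_drop_Suc)
    ultimately show "((aux i \<omega>, st i \<omega>) = (aux i \<omega>', st i \<omega>')) = (hybrid i \<omega> = hybrid i \<omega>')"
      by (auto simp: \<Omega>_def aux_def st_def hybrid_def)
  qed
  moreover have "ent \<Omega> p (\<lambda>\<omega>. (aux i \<omega>, outp i \<omega>)) = ent \<Omega> p (hybrid (Suc i))"
  proof (rule ent_cong_kernel)
    fix \<omega> \<omega>' assume "\<omega> \<in> \<Omega>" "\<omega>' \<in> \<Omega>"
    moreover have "take (Suc i) y = take i y @ [y ! i]" if "y \<in> seqs n" for y :: "'y list"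
      using that i by (simp add: seqs_def take_Suc_conv_app_nth)
    ultimately show "((aux i \<omega>, outp i \<omega>) = (aux i \<omega>', outp i \<omega>')) = (hybrid (Suc i) \<omega> = hybrid (Suc i) \<omega>')"
      by (auto simp: \<Omega>_def aux_def outp_def hybrid_def)
  qed
  ultimately show ?thesis using 1 2 by (simp add: entropy_gap_def sum_subtractf)
qed

section \<open>Time averaging\<close>

text \<open>The range of the time-sharing auxiliary (T, V_T) with T uniform on the n positions;
  \<open>slice\<close> is its joint mass with S_T and X_T, and \<open>avg\<close> is the law of
  (S_T, X_T).\<close>

definition Ix :: "(nat \<times> nat \<times> nat \<times> 'y list \<times> 's list) set" where
  "Ix = (SIGMA i:{..<n}. aux i ` \<Omega>)"

definition slice where
  "slice = (\<lambda>(i, v) s x. 1 / real n * joint i v s x)"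

definition avg where
  "avg s x = (\<Sum>j\<in>Ix. slice j s x)"

lemma finite_Ix: "finite Ix"
  by (simp add: Ix_def)

lemma slice_nonneg: "slice j s x \<ge> 0"
  by (simp add: slice_def joint_nonneg split: prod.split)

lemma avg_nonneg: "avg s x \<ge> 0"
  by (simp add: avg_def slice_nonneg sum_nonneg)

lemma pairing_avg: "pairing avg \<phi> = (\<Sum>i<n. ex (\<lambda>\<omega>. \<phi> (st i \<omega>) (inp i \<omega>))) / real n"
proof -
  have "pairing avg \<phi> = (\<Sum>j\<in>Ix. pairing (slice j) \<phi>)"
    unfolding avg_def[abs_def] by (rule pairing_sum_left)
  also have "\<dots> = (\<Sum>i<n. \<Sum>v\<in>aux i ` \<Omega>. pairing (slice (i, v)) \<phi>)"
    unfolding Ix_def by (subst sum.Sigma) auto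
  also have "\<dots> = (\<Sum>i<n. (\<Sum>v\<in>aux i ` \<Omega>. pairing (joint i v) \<phi>)) / real n"
    by (simp add: slice_def pairing_scale_left[of "1 / real n", simplified] sum_divide_distrib)
  also have "(\<lambda>i. \<Sum>v\<in>aux i ` \<Omega>. pairing (joint i v) \<phi>) = (\<lambda>i. ex (\<lambda>\<omega>. \<phi> (st i \<omega>) (inp i \<omega>)))"
  proof
    fix i
    have "(\<Sum>v\<in>aux i ` \<Omega>. pairing (joint i v) \<phi>)
        = ex (\<lambda>\<omega>. \<Sum>v\<in>aux i ` \<Omega>. (if aux i \<omega> = v then 1 else 0) * \<phi> (st i \<omega>) (inp i \<omega>))"
      by (simp only: pairing_joint ex_sum)
    also have "\<dots> = ex (\<lambda>\<omega>. \<phi> (st i \<omega>) (inp i \<omega>))"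
      by (rule ex_cong) (simp flip: sum_distrib_right)
    finally show "(\<Sum>v\<in>aux i ` \<Omega>. pairing (joint i v) \<phi>) = ex (\<lambda>\<omega>. \<phi> (st i \<omega>) (inp i \<omega>))" .
  qed
  finally show ?thesis .
qed

lemma ex_st:
  assumes "i < n"
  shows "ex (\<lambda>\<omega>. if st i \<omega> = s then 1 else 0) = PS s"
proof -
  have "ex (\<lambda>\<omega>. if st i \<omega> = s then 1 else 0) = ex (\<lambda>(m, k, xs, x, y). if xs ! i = s then 1 else 0)"
    by (rule ex_cong) (auto simp: st_def)
  then show ?thesis
    using ex_state_only[of "\<lambda>xs. if xs ! i = s then 1 else 0"] sum_seq_prob_coordinate[of PS i n s] assms
    by simp
qed

lemma avg_state: "(\<Sum>x\<in>UNIV. avg s x) = PS s"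
  unfolding pairing_state[symmetric] pairing_avg using n by (simp add: ex_st)

lemma out_mass_avg: "out_mass W avg y = (\<Sum>i<n. ex (\<lambda>\<omega>. if outp i \<omega> = y then 1 else 0)) / real n"
proof -
  have "ex (\<lambda>\<omega>. chanY W (st i \<omega>) (inp i \<omega>) y) = ex (\<lambda>\<omega>. if outp i \<omega> = y then 1 else 0)" if "i < n" for i
  proof -
    have "ex (\<lambda>\<omega>. chanY W (st i \<omega>) (inp i \<omega>) y) = ex (\<lambda>(m, k, s, x, ys). 1 * chanY W (s ! i) (x ! i) y)"
      by (rule ex_cong) (auto simp: st_def inp_def)
    also have "\<dots> = ex (\<lambda>(m, k, s, x, ys). 1 * (if ys ! i = y then 1 else 0))"
      by (rule ex_output_coordinate[symmetric]) (use that in auto)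
    also have "\<dots> = ex (\<lambda>\<omega>. if outp i \<omega> = y then 1 else 0)"
      by (rule ex_cong) (auto simp: outp_def)
    finally show ?thesis .
  qed
  then show ?thesis by (simp add: out_mass_def pairing_avg)
qed

lemma sum_entropy_gap_slice:
  "(\<Sum>j\<in>Ix. entropy_gap W (slice j)) = (ent \<Omega> p (hybrid 0) - ent \<Omega> p (hybrid n)) / real n"
proof -
  have "(\<Sum>j\<in>Ix. entropy_gap W (slice j)) = (\<Sum>i<n. \<Sum>v\<in>aux i ` \<Omega>. entropy_gap W (slice (i, v)))"
    unfolding Ix_def by (subst sum.Sigma) auto
  also have "\<dots> = (\<Sum>i<n. \<Sum>v\<in>aux i ` \<Omega>. 1 / real n * entropy_gap W (joint i v))"
    by (intro sum.cong refl) (simp add: slice_def del: times_divide_eq_left, subst entropy_gap_scale, auto simp: joint_nonneg)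
  also have "\<dots> = (\<Sum>i<n. 1 / real n * (ent \<Omega> p (hybrid i) - ent \<Omega> p (hybrid (Suc i))))"
    by (intro sum.cong refl) (simp only: sum_entropy_gap_joint lessThan_iff flip: sum_distrib_left)
  also have "\<dots> = (ent \<Omega> p (hybrid 0) - ent \<Omega> p (hybrid n)) / real n"
    using sum_lessThan_telescope'[of "\<lambda>i. ent \<Omega> p (hybrid i)" n]
    by (simp flip: sum_divide_distrib)
  finally show ?thesis .
qed

section \<open>Entropies at the two ends of the telescoping sum\<close>

lemma ex_log_state: "i < n \<Longrightarrow> ex (\<lambda>\<omega>. log 2 (PS (st i \<omega>))) = (\<Sum>s\<in>UNIV. xlog (PS s))"
  using expectation_pr[of \<Omega> UNIV "st i" p "\<lambda>s. log 2 (PS s)"]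
  by (simp add: ex_def[symmetric] pr_eq_ex ex_st xlog_def)

text \<open>Message, key and state sequence are independent, the first two uniform and the states
  i.i.d., so this entropy is computed exactly.\<close>

lemma ent_hybrid_0:
  "ent \<Omega> p (hybrid 0) = log 2 (real NM) + log 2 (real NK) - real n * (\<Sum>s\<in>UNIV. xlog (PS s))"
proof -
  have pr0: "pr \<Omega> p (hybrid 0) (hybrid 0 (m, k, s, x, y)) = seq_prob PS s / (real NM * real NK)"
    if "(m, k, s, x, y) \<in> \<Omega>" for m k s x y
  proof -
    have mks: "m < NM" "k < NK" "s \<in> seqs n" using that by (auto simp: \<Omega>_def)
    have "pr \<Omega> p (hybrid 0) (hybrid 0 (m, k, s, x, y))
        = ex (\<lambda>(m', k', s', x', y'). (if m' = m then 1 else 0) * ((if k' = k then 1 else 0) * (if s' = s then 1 else 0)))"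
      unfolding pr_eq_ex by (rule ex_cong) (auto simp: hybrid_def split: if_splits)
    also have "\<dots> = (\<Sum>m'<NM. (if m' = m then 1 else 0) * (\<Sum>k'<NK. (if k' = k then 1 else 0) *
        (\<Sum>s'\<in>seqs n. (if s' = s then seq_prob PS s' / (real NM * real NK) else 0))))"
      unfolding ex_state sum_distrib_left by (intro sum.cong refl) auto
    also have "\<dots> = seq_prob PS s / (real NM * real NK)"
      using mks by (simp add: if_distrib[of "\<lambda>t. t * _"] cong: if_cong flip: sum_divide_distrib)
    finally show ?thesis .
  qed
  \<comment> \<open>Points of weight 0 are treated apart, since the logarithm of a product splits
    only over positive factors.\<close>
  have "p \<omega> * log 2 (pr \<Omega> p (hybrid 0) (hybrid 0 \<omega>))
      = p \<omega> * ((\<Sum>i<n. log 2 (PS (st i \<omega>))) - (log 2 (real NM) + log 2 (real NK)))" if w: "\<omega> \<in> \<Omega>" for \<omega>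
  proof (cases "p \<omega> = 0")
    case False
    obtain m k s x y where \<omega>: "\<omega> = (m, k, s, x, y)" by (cases \<omega>) auto
    have s: "length s = n" using w by (simp add: \<omega> \<Omega>_def seqs_def)
    have "seq_prob PS s \<noteq> 0" using False by (auto simp: \<omega> p_def code_weight_def)
    then have pos: "\<forall>i<n. PS (s ! i) > 0"
      using s by (auto simp: seq_prob_def order_less_le)
    have "log 2 (seq_prob PS s) = (\<Sum>i<n. log 2 (PS (s ! i)))"
      unfolding seq_prob_def s by (rule log2_prod) (use pos in auto)
    moreover have "seq_prob PS s > 0" using \<open>seq_prob PS s \<noteq> 0\<close> by (simp add: order_less_le)
    ultimately have "log 2 (seq_prob PS s / (real NM * real NK))
        = (\<Sum>i<n. log 2 (PS (s ! i))) - (log 2 (real NM) + log 2 (real NK))"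
      using NM NK by (simp add: log_divide log_mult)
    then show ?thesis using pr0 w by (simp add: \<omega> st_def)
  qed simp
  then have "ent \<Omega> p (hybrid 0)
      = - ex (\<lambda>\<omega>. (\<Sum>i<n. log 2 (PS (st i \<omega>))) - (log 2 (real NM) + log 2 (real NK)))"
    unfolding ent_def ex_def by (intro arg_cong[of _ _ uminus] sum.cong refl)
  then show ?thesis by (simp add: ex_diff ex_sum ex_const ex_log_state)
qed

text \<open>A letter that occurs at some time stays in the support of the time average, so the
  i.i.d. comparison law is positive on every outcome that occurs.\<close>

lemma out_mass_avg_pos:
  assumes w: "\<omega> \<in> \<Omega>" "p \<omega> > 0" and i: "i < n"
  shows "out_mass W avg (outp i \<omega>) > 0"
proof -
  have "pr \<Omega> p (outp i) (outp i \<omega>) > 0" by (rule pr_pos) (use w p_nonneg in auto)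
  then have "ex (\<lambda>\<omega>'. if outp i \<omega>' = outp i \<omega> then 1 else 0) > 0" by (simp add: pr_eq_ex)
  then have "(\<Sum>i'<n. ex (\<lambda>\<omega>'. if outp i' \<omega>' = outp i \<omega> then 1 else 0)) > 0"
    using i by (intro sum_pos2[of _ i] ex_nonneg) auto
  then show ?thesis using n by (simp add: out_mass_avg)
qed

text \<open>For a fixed comparison law the expected logarithm is linear in the law of Y_i, so
  summing over \<open>i\<close> produces the averaged law. This takes the place of a concavity
  argument for the entropy.\<close>

lemma sum_ex_log_out:
  "(\<Sum>i<n. ex (\<lambda>\<omega>. log 2 (out_mass W avg (outp i \<omega>)))) = real n * (\<Sum>y\<in>UNIV. xlog (out_mass W avg y))"
proof -
  have "ex (\<lambda>\<omega>. log 2 (out_mass W avg (outp i \<omega>)))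
      = (\<Sum>y\<in>UNIV. ex (\<lambda>\<omega>. if outp i \<omega> = y then 1 else 0) * log 2 (out_mass W avg y))" for i
    using expectation_pr[of \<Omega> UNIV "outp i" p "\<lambda>y. log 2 (out_mass W avg y)"]
    by (simp add: ex_def[symmetric] pr_eq_ex)
  then have "(\<Sum>i<n. ex (\<lambda>\<omega>. log 2 (out_mass W avg (outp i \<omega>))))
      = (\<Sum>y\<in>UNIV. (\<Sum>i<n. ex (\<lambda>\<omega>. if outp i \<omega> = y then 1 else 0)) * log 2 (out_mass W avg y))"
    by (simp add: sum_distrib_right) (rule sum.swap)
  also have "\<dots> = (\<Sum>y\<in>UNIV. real n * xlog (out_mass W avg y))"
    using n by (intro sum.cong refl) (simp add: out_mass_avg xlog_def)
  finally show ?thesis by (simp add: sum_distrib_left)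
qed

lemma sum_out_mass_avg: "(\<Sum>y\<in>UNIV. out_mass W avg y) = 1"
  by (simp add: sum_out_mass avg_state)

text \<open>Fano's inequality and the subadditivity of \<open>H(Y\<^sup>n)\<close> in one step: compare with the law under which
  \<open>K\<close> is uniform, the outputs are i.i.d. with the time-averaged law, and the message is the decoded one
  with probability one half and uniform otherwise.\<close>

lemma ent_hybrid_n:
  "ent \<Omega> p (hybrid n) \<le> 1 + error_prob n NM NK PS W enc dec * log 2 (real NM) + log 2 (real NK)
    - real n * (\<Sum>y\<in>UNIV. xlog (out_mass W avg y))"
proof -
  \<comment> \<open>Slightly below the mixture: a correct decision gets 1/2 rather than 1/2 + 1/(2
    NM). The logarithm is then exactly -1, or -1 - log NM on an error, and the total is still at
    most 1.\<close>
  define r where "r m k y = (if dec y k = m then 1 / 2 else 1 / (2 * real NM))" for m k and y :: "'y list"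
  define Q where "Q = (\<lambda>(m, k, y). r m k y / real NK * seq_prob (out_mass W avg) y)"
  define f where "f = (\<lambda>(m :: nat, k :: nat, s :: 's list, x :: 'x list, y :: 'y list). (m, k, y))"
  define A where "A = {..<NM} \<times> {..<NK} \<times> (seqs n :: 'y list set)"
  have out0: "out_mass W avg y \<ge> 0" for y by (simp add: out_mass_nonneg avg_nonneg)
  have r: "r m k y > 0" for m k y using NM by (simp add: r_def)
  have Q0: "Q v \<ge> 0" for v
    using r out0 by (auto simp: Q_def seq_prob_def less_imp_le intro!: mult_nonneg_nonneg prod_nonneg divide_nonneg_nonneg split: prod.split)
  have "ent \<Omega> p (hybrid n) = ent \<Omega> p f"
  proof (rule ent_cong_kernel)
    fix \<omega> \<omega>' assume "\<omega> \<in> \<Omega>" "\<omega>' \<in> \<Omega>"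
    moreover have "take n y = y" if "y \<in> seqs n" for y :: "'y list"
      using that by (simp add: seqs_def)
    moreover have "drop n s = []" if "s \<in> seqs n" for s :: "'s list"
      using that by (simp add: seqs_def)
    ultimately show "(hybrid n \<omega> = hybrid n \<omega>') = (f \<omega> = f \<omega>')"
      by (auto simp: hybrid_def f_def \<Omega>_def)
  qed
  also have "\<dots> \<le> - (\<Sum>\<omega>\<in>\<Omega>. p \<omega> * log 2 (Q (f \<omega>)))"
  proof (rule ent_le_cross_entropy)
    have r_sum: "(\<Sum>m<NM. r m k y) \<le> 1" for k y
    proof -
      have "(\<Sum>m<NM. r m k y) \<le> (\<Sum>m<NM. (if dec y k = m then 1 / 2 else 0) + 1 / (2 * real NM))"
        by (intro sum_mono) (simp add: r_def)
      also have "\<dots> \<le> 1" using NM by (simp add: sum.distrib)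
      finally show ?thesis .
    qed
    have "(\<Sum>v\<in>f ` \<Omega>. Q v) \<le> (\<Sum>v\<in>A. Q v)"
      by (rule sum_mono2) (auto simp: A_def f_def \<Omega>_def Q0)
    also have "\<dots> = (\<Sum>m<NM. \<Sum>k<NK. \<Sum>y\<in>seqs n. r m k y * (seq_prob (out_mass W avg) y / real NK))"
      by (simp add: A_def Q_def sum.cartesian_product split_beta)
    also have "\<dots> = (\<Sum>k<NK. \<Sum>y\<in>seqs n. \<Sum>m<NM. r m k y * (seq_prob (out_mass W avg) y / real NK))"
      by (subst sum.swap) (intro sum.cong refl sum.swap)
    also have "\<dots> = (\<Sum>k<NK. \<Sum>y\<in>seqs n. (\<Sum>m<NM. r m k y) * (seq_prob (out_mass W avg) y / real NK))"
      by (simp only: sum_distrib_right)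
    also have "\<dots> \<le> (\<Sum>k<NK. \<Sum>y\<in>seqs n. 1 * (seq_prob (out_mass W avg) y / real NK))"
      by (intro sum_mono mult_right_mono r_sum) (auto simp: seq_prob_def out0 intro!: divide_nonneg_nonneg prod_nonneg)
    also have "\<dots> = 1"
      using NK by (simp add: sum_seq_prob sum_out_mass_avg flip: sum_divide_distrib)
    finally show "(\<Sum>v\<in>f ` \<Omega>. Q v) \<le> 1" .
    show "Q (f \<omega>) > 0" if "\<omega> \<in> \<Omega>" "p \<omega> > 0" for \<omega>
    proof -
      obtain m k s x y where \<omega>: "\<omega> = (m, k, s, x, y)" by (cases \<omega>) auto
      have "length y = n" using that by (simp add: \<omega> \<Omega>_def seqs_def)
      then have "seq_prob (out_mass W avg) y > 0"
        using out_mass_avg_pos[OF that] by (auto simp: seq_prob_def \<omega> outp_def intro!: prod_pos)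
      then show ?thesis using r NK by (simp add: Q_def f_def \<omega>)
    qed
  qed (use p_nonneg sum_p Q0 in auto)
  also have "\<dots> = - ex (\<lambda>\<omega>. log 2 (Q (f \<omega>)))" by (simp add: ex_def)
  also have "ex (\<lambda>\<omega>. log 2 (Q (f \<omega>))) = ex (\<lambda>\<omega>. (\<Sum>i<n. log 2 (out_mass W avg (outp i \<omega>)))
      - (1 + log 2 (real NK) + (case \<omega> of (m, k, s, x, y) \<Rightarrow> if dec y k \<noteq> m then 1 else 0) * log 2 (real NM)))"
    unfolding ex_def
  proof (rule sum.cong[OF refl])
    fix \<omega> assume w: "\<omega> \<in> \<Omega>"
    show "p \<omega> * log 2 (Q (f \<omega>)) = p \<omega> * ((\<Sum>i<n. log 2 (out_mass W avg (outp i \<omega>)))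
      - (1 + log 2 (real NK) + (case \<omega> of (m, k, s, x, y) \<Rightarrow> if dec y k \<noteq> m then 1 else 0) * log 2 (real NM)))"
    proof (cases "p \<omega> = 0")
      case False
      obtain m k s x y where \<omega>: "\<omega> = (m, k, s, x, y)" by (cases \<omega>) auto
      have y: "length y = n" using w by (simp add: \<omega> \<Omega>_def seqs_def)
      have "p \<omega> > 0" using False p_nonneg[OF w] by simp
      from out_mass_avg_pos[OF w this] have pos: "\<forall>i<n. out_mass W avg (y ! i) > 0"
        by (simp add: \<omega> outp_def)
      have "seq_prob (out_mass W avg) y > 0" using pos y by (auto simp: seq_prob_def intro!: prod_pos)
      then have "log 2 (Q (m, k, y)) = log 2 (r m k y) - log 2 (real NK) + log 2 (seq_prob (out_mass W avg) y)"
        using r[of m k y] NK by (simp add: Q_def log_mult log_divide)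
      also have "log 2 (r m k y) = - 1 - (if dec y k \<noteq> m then 1 else 0) * log 2 (real NM)"
        using NM by (simp add: r_def log_divide log_mult)
      also have "log 2 (seq_prob (out_mass W avg) y) = (\<Sum>i<n. log 2 (out_mass W avg (y ! i)))"
        unfolding seq_prob_def y by (rule log2_prod) (use pos in auto)
      finally show ?thesis by (simp add: \<omega> f_def outp_def)
    qed simp
  qed
  also have "\<dots> = real n * (\<Sum>y\<in>UNIV. xlog (out_mass W avg y))
      - (1 + log 2 (real NK) + error_prob n NM NK PS W enc dec * log 2 (real NM))"
  proof -
    have "ex (\<lambda>(m, k, s, x, y). if dec y k \<noteq> m then 1 else 0) = error_prob n NM NK PS W enc dec"
      by (simp add: ex_eq error_prob_def)
    then show ?thesis
      by (simp only: ex_diff ex_add ex_scale ex_const ex_sum sum_ex_log_out)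
  qed
  finally show ?thesis by simp
qed

text \<open>The price of Fano's inequality is the factor one minus the error probability and the 1
  subtracted before division by n; both disappear in the limit.\<close>

lemma single_letter_bound:
  "((1 - error_prob n NM NK PS W enc dec) * log 2 (real NM) - 1) / real n
    \<le> (\<Sum>j\<in>Ix. entropy_gap W (slice j)) - (\<Sum>y\<in>UNIV. xlog (out_mass W avg y)) + (\<Sum>s\<in>UNIV. xlog (PS s))"
proof -
  have "(1 - error_prob n NM NK PS W enc dec) * log 2 (real NM) - 1
    \<le> ent \<Omega> p (hybrid 0) - ent \<Omega> p (hybrid n)
      + real n * ((\<Sum>s\<in>UNIV. xlog (PS s)) - (\<Sum>y\<in>UNIV. xlog (out_mass W avg y)))"
    using ent_hybrid_n[of dec] by (simp add: ent_hybrid_0 algebra_simps)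
  then have "((1 - error_prob n NM NK PS W enc dec) * log 2 (real NM) - 1) / real n
    \<le> (ent \<Omega> p (hybrid 0) - ent \<Omega> p (hybrid n)
      + real n * ((\<Sum>s\<in>UNIV. xlog (PS s)) - (\<Sum>y\<in>UNIV. xlog (out_mass W avg y)))) / real n"
    by (rule divide_right_mono) simp
  also have "\<dots> = (\<Sum>j\<in>Ix. entropy_gap W (slice j)) - (\<Sum>y\<in>UNIV. xlog (out_mass W avg y)) + (\<Sum>s\<in>UNIV. xlog (PS s))"
    using n by (simp add: sum_entropy_gap_slice add_divide_distrib)
  finally show ?thesis .
qed

lemma error_prob_le_1: "error_prob n NM NK PS W enc dec \<le> 1"
proof -
  have "error_prob n NM NK PS W enc dec = ex (\<lambda>(m, k, s, x, y). if dec y k \<noteq> m then 1 else 0)"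
    by (simp add: ex_eq error_prob_def)
  also have "\<dots> \<le> ex (\<lambda>_. 1)"
    unfolding ex_def by (intro sum_mono mult_left_mono p_nonneg) auto
  finally show ?thesis by (simp add: ex_one)
qed

section \<open>Cost and warden law of a code\<close>

lemma pairing_avg_cost: "pairing avg (\<lambda>s x. b x) = expected_cost n NM NK PS b enc"
proof -
  have "pairing avg (\<lambda>s x. b x) = ex (\<lambda>(m, k, s, x, y). (\<Sum>i<n. b (x ! i)) * (1 / real n))"
  proof -
    have "pairing avg (\<lambda>s x. b x) = ex (\<lambda>\<omega>. (\<Sum>i<n. b (inp i \<omega>)) * (1 / real n))"
      by (simp only: pairing_avg ex_sum ex_scale) simp
    also have "\<dots> = ex (\<lambda>(m, k, s, x, y). (\<Sum>i<n. b (x ! i)) * (1 / real n))"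
      by (rule ex_cong) (auto simp: inp_def)
    finally show ?thesis .
  qed
  also have "\<dots> = expected_cost n NM NK PS b enc"
    unfolding ex_no_output expected_cost_def avg_cost_def
    by (intro sum.cong refl) (simp add: seqs_def)
  finally show ?thesis .
qed

lemma warden_dist_nonneg: "warden_dist n NM NK PS W enc zs \<ge> 0"
  unfolding warden_dist_def by (intro sum_nonneg mult_nonneg_nonneg cw_nonneg) auto

lemma sum_warden_dist_mult:
  "(\<Sum>zs\<in>seqs n. warden_dist n NM NK PS W enc zs * g zs)
    = ex (\<lambda>(m, k, s, x, y). \<Sum>zs\<in>seqs n. chan_prod (chanZ W) s x zs * g zs)"
proof -
  have "(\<Sum>zs\<in>seqs n. warden_dist n NM NK PS W enc zs * g zs)
    = (\<Sum>zs\<in>seqs n. ex (\<lambda>(m, k, s, x, y). chan_prod (chanZ W) s x zs * g zs))"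
    unfolding ex_no_output warden_dist_def sum_distrib_right by (simp add: mult.assoc)
  also have "\<dots> = ex (\<lambda>(m, k, s, x, y). \<Sum>zs\<in>seqs n. chan_prod (chanZ W) s x zs * g zs)"
    unfolding ex_sum[symmetric] by (rule ex_cong) auto
  finally show ?thesis .
qed

lemma sum_warden_dist: "(\<Sum>zs\<in>seqs n. warden_dist n NM NK PS W enc zs) = 1"
proof -
  have "(\<Sum>zs\<in>seqs n. warden_dist n NM NK PS W enc zs * 1) = ex (\<lambda>_. 1)"
    unfolding sum_warden_dist_mult
    by (rule ex_cong) (auto simp: \<Omega>_def sum_chan_prod)
  then show ?thesis by (simp add: ex_one)
qed

text \<open>The expected number of occurrences of \<open>z\<close> is additive over time, so it sees
  the warden's law only through the single-letter marginal of \<open>avg\<close>.\<close>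

lemma sum_warden_dist_count:
  "(\<Sum>zs\<in>seqs n. warden_dist n NM NK PS W enc zs * (\<Sum>i<n. if zs ! i = z then 1 else 0))
    = real n * pairing avg (\<lambda>s x. chanZ W s x z)"
proof -
  have "(\<Sum>zs\<in>seqs n. warden_dist n NM NK PS W enc zs * (\<Sum>i<n. if zs ! i = z then 1 else 0))
      = ex (\<lambda>\<omega>. \<Sum>i<n. chanZ W (st i \<omega>) (inp i \<omega>) z)"
    unfolding sum_warden_dist_mult
  proof (rule ex_cong)
    fix \<omega> assume "\<omega> \<in> \<Omega>"
    then obtain m k s x y where \<omega>: "\<omega> = (m, k, s, x, y)" "s \<in> seqs n" by (auto simp: \<Omega>_def)
    have "(\<Sum>zs\<in>seqs n. chan_prod (chanZ W) s x zs * (\<Sum>i<n. if zs ! i = z then 1 else 0))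
        = (\<Sum>i<n. \<Sum>zs\<in>seqs n. chan_prod (chanZ W) s x zs * 1 * (if zs ! i = z then 1 else 0))"
      unfolding sum_distrib_left by (subst sum.swap) simp
    also have "\<dots> = (\<Sum>i<n. chanZ W (s ! i) (x ! i) z)"
      using \<omega>(2) by (intro sum.cong refl, subst sum_chan_prod_coordinate) (auto simp: sum_chan_prod)
    finally show "(case \<omega> of (m, k, s, x, y) \<Rightarrow> \<Sum>zs\<in>seqs n. chan_prod (chanZ W) s x zs * (\<Sum>i<n. if zs ! i = z then 1 else 0))
        = (\<Sum>i<n. chanZ W (st i \<omega>) (inp i \<omega>) z)"
      by (simp add: \<omega> st_def inp_def)
  qed
  then show ?thesis using n by (simp add: pairing_avg ex_sum)
qed

end

subsection \<open>Covertness and the limit\<close>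

text \<open>Compare \<open>P\<close> with the product of the law proportional to \<open>Q z' exp (t [z' = z])\<close>.\<close>

lemma count_le_kl_div:
  fixes P :: "'z::finite list \<Rightarrow> real" and Q :: "'z \<Rightarrow> real"
  assumes P: "\<And>zs. P zs \<ge> 0" "(\<Sum>zs\<in>seqs n. P zs) = 1"
    and Q: "\<And>z. Q z > 0" "(\<Sum>z\<in>UNIV. Q z) = 1" and t: "t \<ge> 0"
  shows "t * (\<Sum>zs\<in>seqs n. P zs * (\<Sum>i<n. if zs ! i = z then 1 else 0))
    \<le> kl_div (seqs n) P (seq_prob Q) + real n * (Q z * (exp t - 1))"
proof -
  define c where "c zs = (\<Sum>i<n. if zs ! i = z then 1 else (0 :: real))" for zs
  define N where "N = 1 + Q z * (exp t - 1)"
  have "Q z * (exp t - 1) \<ge> 0" using Q(1)[of z] t by (intro mult_nonneg_nonneg) auto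
  then have N: "N > 0" by (simp add: N_def)
  define T where "T z' = Q z' * (if z' = z then exp t else 1) / N" for z'
  have T: "T z' > 0" for z' using Q N by (simp add: T_def)
  have "(\<Sum>z'\<in>UNIV. Q z' * (if z' = z then exp t else 1))
      = (\<Sum>z'\<in>UNIV. Q z' + (if z' = z then Q z * (exp t - 1) else 0))"
    by (intro sum.cong refl) (simp add: algebra_simps)
  also have "\<dots> = N" by (simp add: sum.distrib Q N_def)
  finally have T1: "(\<Sum>z'\<in>UNIV. T z') = 1" using N by (simp add: T_def flip: sum_divide_distrib)
  have pos: "seq_prob Q zs > 0" "seq_prob T zs > 0" for zs
    using Q T by (auto simp: seq_prob_def intro!: prod_pos)
  have ln_seq: "ln (seq_prob F zs) = (\<Sum>i<n. ln (F (zs ! i)))"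
    if "zs \<in> seqs n" "\<And>z. F z > 0" for F :: "'z \<Rightarrow> real" and zs
    using that by (simp add: seq_prob_def seqs_def ln_prod less_imp_neq[symmetric])
  have lnT: "ln (seq_prob T zs) = ln (seq_prob Q zs) + t * c zs - real n * ln N" if zs: "zs \<in> seqs n" for zs
  proof -
    have "ln (T z') = ln (Q z') + t * (if z' = z then 1 else 0) - ln N" for z'
      using Q(1)[of z'] N by (simp add: T_def ln_div ln_mult)
    then show ?thesis
      using zs Q T by (simp add: ln_seq c_def sum.distrib sum_subtractf sum_distrib_left)
  qed
  \<comment> \<open>The Gibbs variational inequality pointwise, from \<open>ln u \<le> u - 1\<close>
    at \<open>u = seq_prob T zs / P zs\<close>; the terms \<open>P zs - seq_prob T zs\<close> sum to
    0.\<close>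
  have "P zs * (t * c zs - real n * ln N) + P zs - seq_prob T zs
      \<le> (if P zs = 0 then 0 else P zs * ln (P zs / seq_prob Q zs))" if zs: "zs \<in> seqs n" for zs
  proof (cases "P zs = 0")
    case False
    then have p: "P zs > 0" using P(1)[of zs] by simp
    have "P zs * ln (seq_prob T zs / P zs) \<le> P zs * (seq_prob T zs / P zs - 1)"
      using p pos by (intro mult_left_mono ln_le_minus_one) auto
    also have "\<dots> = seq_prob T zs - P zs" using p by (simp add: right_diff_distrib)
    also have "ln (seq_prob T zs / P zs) = t * c zs - real n * ln N - ln (P zs / seq_prob Q zs)"
      using p pos[of zs] by (simp add: ln_divide_pos lnT[OF zs])
    finally show ?thesis using p by (simp add: algebra_simps)
  qed (use pos in \<open>simp add: less_imp_le\<close>)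
  then have "(\<Sum>zs\<in>seqs n. P zs * (t * c zs - real n * ln N) + P zs - seq_prob T zs)
      \<le> kl_div (seqs n) P (seq_prob Q)"
    unfolding kl_div_def by (rule sum_mono)
  moreover have "(\<Sum>zs\<in>seqs n. P zs * (t * c zs - real n * ln N) + P zs - seq_prob T zs)
      = t * (\<Sum>zs\<in>seqs n. P zs * c zs) - real n * ln N"
  proof -
    have "(\<Sum>zs\<in>seqs n. P zs * (t * c zs)) = t * (\<Sum>zs\<in>seqs n. P zs * c zs)"
      by (simp add: sum_distrib_left mult_ac)
    moreover have "(\<Sum>zs\<in>seqs n. P zs * (real n * ln N)) = real n * ln N"
      using P(2) by (simp flip: sum_distrib_right)
    ultimately show ?thesis
      using P(2) sum_seq_prob[OF T1, of n]
      by (simp add: right_diff_distrib sum.distrib sum_subtractf)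
  qed
  moreover have "real n * ln N \<le> real n * (Q z * (exp t - 1))"
    using ln_le_minus_one[OF N] by (intro mult_left_mono) (auto simp: N_def)
  ultimately show ?thesis by (simp add: c_def)
qed

text \<open>The warden bound is kept for every \<open>t > 0\<close> because two limits follow: n to
  infinity at fixed \<open>t\<close>, then \<open>t\<close> to 0, where
  \<open>(exp t - 1) / t\<close> tends to 1.\<close>

lemma (in nc_code) exists_single_letter:
  fixes b :: "'x \<Rightarrow> real" and Q :: "'z \<Rightarrow> real"
  assumes Q: "\<And>z. Q z > 0" "(\<Sum>z\<in>UNIV. Q z) = 1"
  defines "k \<equiv> aux_bound TYPE('s) TYPE('x) TYPE('y) TYPE('z)"
  shows "\<exists>PUS xf. (\<forall>s. is_pmf_on {0..<k} (PUS s))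
    \<and> (\<forall>z t. t > 0 \<longrightarrow> (\<Sum>s\<in>UNIV. \<Sum>u<k. PS s * PUS s u * chanZ W s (xf u s) z)
          \<le> kl_div (seqs n) (warden_dist n NM NK PS W enc) (seq_prob Q) / (real n * t) + Q z * ((exp t - 1) / t))
    \<and> (\<Sum>s\<in>UNIV. \<Sum>u<k. PS s * PUS s u * b (xf u s)) = expected_cost n NM NK PS b enc
    \<and> ((1 - error_prob n NM NK PS W enc dec) * log 2 (real NM) - 1) / real n \<le> nc_objective PS W k PUS xf"
proof -
  have avg': "(\<Sum>x\<in>UNIV. \<Sum>j\<in>Ix. slice j s x) = PS s" for s
    using avg_state by (simp add: avg_def)
  from exists_small_auxiliary[of Ix slice PS b, OF finite_Ix slice_nonneg[THEN allI, THEN allI, THEN ballI] avg',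
      folded k_def avg_def]
  obtain PUS xf where P: "\<forall>s. is_pmf_on {0..<k} (PUS s)"
    and Z: "\<forall>z. (\<Sum>s\<in>UNIV. \<Sum>u<k. PS s * PUS s u * chanZ W s (xf u s) z) = pairing avg (\<lambda>s x. chanZ W s x z)"
    and cost: "(\<Sum>s\<in>UNIV. \<Sum>u<k. PS s * PUS s u * b (xf u s)) = pairing avg (\<lambda>s x. b x)"
    and obj: "(\<Sum>j\<in>Ix. entropy_gap W (slice j)) - (\<Sum>y\<in>UNIV. xlog (out_mass W avg y))
      + (\<Sum>s\<in>UNIV. xlog (PS s)) \<le> nc_objective PS W k PUS xf"
    by (elim exE conjE) (rule that)
  have "pairing avg (\<lambda>s x. chanZ W s x z)
      \<le> kl_div (seqs n) (warden_dist n NM NK PS W enc) (seq_prob Q) / (real n * t) + Q z * ((exp t - 1) / t)"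
    if t: "t > 0" for z t
  proof -
    have "t * (real n * pairing avg (\<lambda>s x. chanZ W s x z))
      \<le> kl_div (seqs n) (warden_dist n NM NK PS W enc) (seq_prob Q) + real n * (Q z * (exp t - 1))"
      using count_le_kl_div[of "warden_dist n NM NK PS W enc" n Q t z] warden_dist_nonneg sum_warden_dist Q t
      by (simp add: sum_warden_dist_count)
    then have "pairing avg (\<lambda>s x. chanZ W s x z)
      \<le> (kl_div (seqs n) (warden_dist n NM NK PS W enc) (seq_prob Q) + real n * (Q z * (exp t - 1))) / (real n * t)"
      using n t by (simp add: pos_le_divide_eq mult_ac)
    then show ?thesis using n by (simp add: add_divide_distrib)
  qed
  then show ?thesis
    using P Z cost obj single_letter_bound[of dec] pairing_avg_cost[of b]
    by (intro exI[of _ PUS] exI[of _ xf]) auto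
qed

section \<open>Continuity, compactness and the limit\<close>

text \<open>Only the limit 0 needs care: \<open>ln u \<le> u - 1\<close> at
  \<open>u = 1 / sqrt t\<close> gives |t ln t| \<le> 2 sqrt t for 0 < t < 1.\<close>

lemma tendsto_xlog:
  assumes f: "f \<longlonglongrightarrow> l" and nn: "\<And>n. f n \<ge> 0"
  shows "(\<lambda>n. xlog (f n)) \<longlonglongrightarrow> xlog l"
proof (cases "l = 0")
  case False
  then have "l > 0" using LIMSEQ_le_const[OF f, of 0] nn by force
  then show ?thesis unfolding xlog_def using f by (intro tendsto_intros) auto
next
  case True
  have bound: "\<bar>xlog t\<bar> \<le> 2 * sqrt t / ln 2" if "t \<ge> 0" "t < 1" for t
  proof (cases "t = 0")
    case False
    then have t: "t > 0" using that by simp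
    have "- ln t / 2 = ln (1 / sqrt t)" using t by (simp add: ln_div ln_sqrt)
    also have "\<dots> \<le> 1 / sqrt t" using t ln_le_minus_one[of "1 / sqrt t"] by simp
    finally have "t * (- ln t / 2) \<le> t * (1 / sqrt t)" using t by (intro mult_left_mono) auto
    then have "- (t * ln t) \<le> 2 * sqrt t" using t by (simp add: real_div_sqrt)
    moreover have "t * ln t \<le> 0" using t that by (simp add: mult_nonneg_nonpos)
    ultimately have "\<bar>t * ln t\<bar> / ln 2 \<le> 2 * sqrt t / ln 2" by (intro divide_right_mono) auto
    then show ?thesis by (simp add: xlog_def log_def)
  qed simp
  have "(\<lambda>n. xlog (f n)) \<longlonglongrightarrow> 0"
  proof (rule Lim_null_comparison)
    have "\<forall>\<^sub>F n in sequentially. f n < 1" using f True by (intro order_tendstoD(2)[OF f]) auto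
    then show "\<forall>\<^sub>F n in sequentially. norm (xlog (f n)) \<le> 2 * sqrt (f n) / ln 2"
      by eventually_elim (use bound nn in auto)
    have "(\<lambda>n. 2 * sqrt (f n) / ln 2) \<longlonglongrightarrow> 2 * sqrt l / ln 2" by (intro tendsto_intros f) auto
    then show "(\<lambda>n. 2 * sqrt (f n) / ln 2) \<longlonglongrightarrow> 0" using True by simp
  qed
  then show ?thesis using True by simp
qed

text \<open>The quotients in \<open>mutual_info\<close> can degenerate when masses vanish in the
  limit. Rewritten with \<open>xlog\<close>, the objective is a finite sum of continuous functions
  of the conditional law.\<close>

lemma (in channel) tendsto_nc_objective:
  assumes P: "\<And>s u. u < k \<Longrightarrow> (\<lambda>n. P n s u) \<longlonglongrightarrow> Pl s u" and nn: "\<And>n s u. u < k \<Longrightarrow> P n s u \<ge> 0"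
    and PS: "\<And>s. PS s \<ge> 0"
  shows "(\<lambda>n. nc_objective PS W k (P n) xf) \<longlonglongrightarrow> nc_objective PS W k Pl xf"
proof -
  have nl: "Pl s u \<ge> 0" if "u < k" for s u
    using LIMSEQ_le_const[OF P[OF that], of 0] nn[OF that] by auto
  have gap: "entropy_gap W (graph_mass (\<lambda>s. PS s * R s u) (xf u))
      = (\<Sum>y\<in>UNIV. xlog (\<Sum>s\<in>UNIV. PS s * R s u * chanY W s (xf u s) y)) - (\<Sum>s\<in>UNIV. xlog (PS s * R s u))"
    for R u by (simp add: entropy_gap_def out_mass_def)
  define G where "G R = (\<Sum>u<k. (\<Sum>y\<in>UNIV. xlog (\<Sum>s\<in>UNIV. PS s * R s u * chanY W s (xf u s) y))
          - (\<Sum>s\<in>UNIV. xlog (PS s * R s u)))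
        - (\<Sum>y\<in>UNIV. xlog (\<Sum>u<k. \<Sum>s\<in>UNIV. PS s * R s u * chanY W s (xf u s) y))
        + (\<Sum>s\<in>UNIV. xlog (\<Sum>u<k. PS s * R s u))" for R
  have eq: "nc_objective PS W k R xf = G R" if "\<And>s u. u < k \<Longrightarrow> R s u \<ge> 0" for R
    unfolding G_def gap[symmetric] by (rule nc_objective_eq_entropy_gap) (use that PS in auto)
  have "(\<lambda>n. G (P n)) \<longlonglongrightarrow> G Pl"
    unfolding G_def
    by (intro tendsto_intros tendsto_xlog P sum_nonneg mult_nonneg_nonneg PS nn) auto
  then show ?thesis using eq[of Pl] eq[of "P _"] nl nn by simp
qed

lemma convergent_subsequence_finite_family:
  fixes a :: "nat \<Rightarrow> 'i \<Rightarrow> real"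
  assumes "finite I" "\<And>n i. i \<in> I \<Longrightarrow> a n i \<in> {0..1}"
  shows "\<exists>r l. strict_mono (r :: nat \<Rightarrow> nat) \<and> (\<forall>i\<in>I. (\<lambda>n. a (r n) i) \<longlonglongrightarrow> l i)"
  using assms
proof (induction I rule: finite_induct)
  case empty
  show ?case by (intro exI[of _ id]) (auto simp: strict_mono_def)
next
  case (insert i I)
  then obtain r l where r: "strict_mono (r :: nat \<Rightarrow> nat)" "\<forall>j\<in>I. (\<lambda>n. a (r n) j) \<longlonglongrightarrow> l j" by auto
  have "seq_compact {0..1 :: real}" using compact_imp_seq_compact compact_Icc by blast
  moreover have "\<forall>n. a (r n) i \<in> {0..1}" using insert by simp
  ultimately have "\<exists>t\<in>{0..1}. \<exists>r'. strict_mono (r' :: nat \<Rightarrow> nat) \<and> ((\<lambda>n. a (r n) i) \<circ> r') \<longlonglongrightarrow> t"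
    unfolding seq_compact_def by meson
  then obtain t r' where r': "strict_mono (r' :: nat \<Rightarrow> nat)" "((\<lambda>n. a (r n) i) \<circ> r') \<longlonglongrightarrow> t"
    by blast
  have "(\<lambda>n. a ((r \<circ> r') n) j) \<longlonglongrightarrow> (l(i := t)) j" if "j \<in> insert i I" for j
  proof (cases "j = i")
    case True
    then show ?thesis using r' by (simp add: o_def)
  next
    case False
    then show ?thesis using that r(2) LIMSEQ_subseq_LIMSEQ[OF _ r'(1)] by (auto simp: o_def)
  qed
  then show ?case using strict_mono_o[OF r(1) r'(1)] by blast
qed

lemma set_size_pos: "set_size n R > 0"
  by (simp add: set_size_def)

lemma log_set_size: "real n * R \<le> log 2 (real (set_size n R))"
proof -
  have "2 powr (real n * R) \<le> real (set_size n R)"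
    unfolding set_size_def by (rule real_nat_ceiling_ge)
  then show ?thesis using set_size_pos[of n R] by (simp add: le_log_iff)
qed

lemma (in channel) achievable_imp_feasible:
  fixes PS :: "'s \<Rightarrow> real" and b :: "'x \<Rightarrow> real"
  assumes PS: "is_pmf_on UNIV PS" and Q0: "\<forall>z. Q0 PS W x0 z > 0"
    and R: "nc_achievable PS W x0 b RK B R"
  defines "k \<equiv> aux_bound TYPE('s) TYPE('x) TYPE('y) TYPE('z)"
  shows "\<exists>PUS xf. nc_feasible PS W x0 b B k PUS xf \<and> R \<le> nc_objective PS W k PUS xf"
proof -
  define Q where "Q = Q0 PS W x0"
  have PS0: "PS s \<ge> 0" and PS1: "(\<Sum>s\<in>UNIV. PS s) = 1" for s
    using PS by (auto simp: is_pmf_on_def)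
  have Q: "Q z > 0" for z using Q0 by (simp add: Q_def)
  have Q1: "(\<Sum>z\<in>UNIV. Q z) = 1"
    unfolding Q_def Q0_def by (subst sum.swap) (simp add: PS1 flip: sum_distrib_left)
  obtain enc :: "nat \<Rightarrow> nat \<Rightarrow> nat \<Rightarrow> 's list \<Rightarrow> 'x list \<Rightarrow> real" and dec :: "nat \<Rightarrow> 'y list \<Rightarrow> nat \<Rightarrow> nat"
    where R0: "R \<ge> 0" and enc: "\<forall>n. nc_encoder n (set_size n R) (set_size n RK) (enc n)"
      and cost: "limsup (\<lambda>n. ereal (expected_cost n (set_size n R) (set_size n RK) PS b (enc n))) \<le> ereal B"
      and err: "(\<lambda>n. error_prob n (set_size n R) (set_size n RK) PS W (enc n) (dec n)) \<longlonglongrightarrow> 0"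
      and kl: "(\<lambda>n. kl_div (seqs n) (warden_dist n (set_size n R) (set_size n RK) PS W (enc n)) (seq_prob Q)) \<longlonglongrightarrow> 0"
    using R[unfolded nc_achievable_def, folded Q_def] by (elim exE conjE) (rule that)
  define C where "C n = expected_cost n (set_size n R) (set_size n RK) PS b (enc n)" for n
  define E where "E n = error_prob n (set_size n R) (set_size n RK) PS W (enc n) (dec n)" for n
  define D where "D n = kl_div (seqs n) (warden_dist n (set_size n R) (set_size n RK) PS W (enc n)) (seq_prob Q)" for n
  define good where "good n PUS xf \<longleftrightarrow> (\<forall>s. is_pmf_on {0..<k} (PUS s))
    \<and> (\<forall>z t. t > 0 \<longrightarrow> (\<Sum>s\<in>UNIV. \<Sum>u<k. PS s * PUS s u * chanZ W s (xf u s) z)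
          \<le> D n / (real n * t) + Q z * ((exp t - 1) / t))
    \<and> (\<Sum>s\<in>UNIV. \<Sum>u<k. PS s * PUS s u * b (xf u s)) = C n
    \<and> (1 - E n) * R - 1 / real n \<le> nc_objective PS W k PUS xf" for n PUS and xf :: "nat \<Rightarrow> 's \<Rightarrow> 'x"
  \<comment> \<open>Averages over positions make no sense at blocklength 0, hence the shift by
    one.\<close>
  have "\<exists>PUS xf. good (Suc n) PUS xf" for n
  proof -
    interpret nc_code W PS "Suc n" "set_size (Suc n) R" "set_size (Suc n) RK" "enc (Suc n)"
      using PS enc by unfold_locales (auto simp: set_size_pos)
    have "(1 - E (Suc n)) * R - 1 / real (Suc n)
        = ((1 - E (Suc n)) * (real (Suc n) * R) - 1) / real (Suc n)"
      by (simp add: diff_divide_distrib)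
    also have "\<dots> \<le> ((1 - E (Suc n)) * log 2 (real (set_size (Suc n) R)) - 1) / real (Suc n)"
      using error_prob_le_1[of "dec (Suc n)"] log_set_size[of "Suc n" R]
      by (intro divide_right_mono diff_right_mono mult_left_mono) (auto simp: E_def)
    finally have le: "(1 - E (Suc n)) * R - 1 / real (Suc n) \<le> \<dots>" .
    from exists_single_letter[of Q b "dec (Suc n)", OF Q Q1, folded k_def C_def D_def E_def]
    obtain PUS xf where "\<forall>s. is_pmf_on {0..<k} (PUS s)"
      "\<forall>z t. t > 0 \<longrightarrow> (\<Sum>s\<in>UNIV. \<Sum>u<k. PS s * PUS s u * chanZ W s (xf u s) z)
          \<le> D (Suc n) / (real (Suc n) * t) + Q z * ((exp t - 1) / t)"
      "(\<Sum>s\<in>UNIV. \<Sum>u<k. PS s * PUS s u * b (xf u s)) = C (Suc n)"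
      "((1 - E (Suc n)) * log 2 (real (set_size (Suc n) R)) - 1) / real (Suc n) \<le> nc_objective PS W k PUS xf"
      by (elim exE conjE) (rule that)
    then have "good (Suc n) PUS xf"
      unfolding good_def using le by (intro conjI) (assumption+, linarith)
    then show ?thesis by blast
  qed
  then obtain P X where PX: "\<And>n. good (Suc n) (P n) (X n)" by metis
  \<comment> \<open>Fixing the values outside the alphabet leaves finitely many functions, so one of
    them recurs infinitely often. Along that subsequence only the real parameters still
    vary.\<close>
  define X' where "X' n u = (if u \<in> {..<k} then X n u else undefined)" for n u
  have obj_cong: "nc_objective PS W k p (X' n) = nc_objective PS W k p (X n)" for p n
    by (simp add: nc_objective_def mutual_info_def X'_def cong: if_cong)
  have good': "good (Suc n) (P n) (X' n)" for n
    using PX[of n] unfolding good_def obj_cong by (simp add: X'_def)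
  have "range X' \<subseteq> {f. \<forall>u. (u \<in> {..<k} \<longrightarrow> f u \<in> UNIV) \<and> (u \<notin> {..<k} \<longrightarrow> f u = undefined)}"
    by (auto simp: X'_def)
  then have "finite (range X')" by (rule finite_subset) (intro finite_set_of_finite_funs; simp)
  then obtain n0 where "infinite {n. X' n = X' n0}"
    using pigeonhole_infinite[of "UNIV :: nat set" X'] by auto
  then obtain r1 where r1: "strict_mono (r1 :: nat \<Rightarrow> nat)" "\<forall>n. r1 n \<in> {n. X' n = X' n0}"
    using infinite_enumerate by blast
  define xf where "xf = X' n0"
  have P01: "P n s u \<in> {0..1}" if "u < k" for n s u
  proof -
    have "is_pmf_on {0..<k} (P n s)" using PX[of n] by (simp add: good_def)
    then have nn: "\<forall>u<k. P n s u \<ge> 0" and s1: "(\<Sum>u<k. P n s u) = 1"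
      by (auto simp: is_pmf_on_def atLeast0LessThan)
    have "P n s u \<le> (\<Sum>u<k. P n s u)" using that nn by (intro member_le_sum) auto
    then show ?thesis using nn s1 that by simp
  qed
  obtain r2 l where r2: "strict_mono (r2 :: nat \<Rightarrow> nat)"
    and l: "\<forall>su\<in>UNIV \<times> {..<k}. (\<lambda>n. P (r1 (r2 n)) (fst su) (snd su)) \<longlonglongrightarrow> l su"
    using convergent_subsequence_finite_family[of "UNIV \<times> {..<k}" "\<lambda>n su. P (r1 n) (fst su) (snd su)"] P01
    by fastforce
  define r where "r = r1 \<circ> r2"
  define p where "p s u = l (s, u)" for s u
  have r: "strict_mono r" using r1(1) r2 by (simp add: r_def strict_mono_o)
  have Sr: "strict_mono (Suc \<circ> r)" using r by (simp add: strict_mono_def)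
  have lim: "(\<lambda>n. P (r n) s u) \<longlonglongrightarrow> p s u" if "u < k" for s u
    using l that by (force simp: r_def p_def)
  have good_r: "good (Suc (r n)) (P (r n)) xf" for n
    using good'[of "r n"] r1(2) by (simp add: r_def xf_def)
  have pmf_r: "is_pmf_on {0..<k} (P (r n) s)" for n s using good_r[of n] by (simp add: good_def)
  have p0: "p s u \<ge> 0" if "u < k" for s u
    using LIMSEQ_le_const[OF lim[OF that], of 0] P01[OF that] by fastforce
  have p1: "(\<Sum>u<k. p s u) = 1" for s
  proof -
    have "(\<lambda>n. \<Sum>u<k. P (r n) s u) \<longlonglongrightarrow> (\<Sum>u<k. p s u)" by (intro tendsto_sum lim) simp
    moreover have "(\<Sum>u<k. P (r n) s u) = 1" for n
      using pmf_r[of n s] by (simp add: is_pmf_on_def atLeast0LessThan)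
    ultimately show ?thesis using LIMSEQ_unique[OF _ tendsto_const] by simp
  qed
  have "is_pmf_on {0..<k} (p s)" for s
    using p0 p1 by (simp add: is_pmf_on_def atLeast0LessThan)
  \<comment> \<open>The single-letter cost equals the cost of the code, so its limit along the
    subsequence is at most the limsup of the whole sequence.\<close>
  moreover have "(\<Sum>s\<in>UNIV. \<Sum>u<k. PS s * p s u * b (xf u s)) \<le> B"
  proof -
    have "(\<lambda>n. \<Sum>s\<in>UNIV. \<Sum>u<k. PS s * P (r n) s u * b (xf u s)) \<longlonglongrightarrow> (\<Sum>s\<in>UNIV. \<Sum>u<k. PS s * p s u * b (xf u s))"
      by (intro tendsto_intros lim) simp
    moreover have "(\<Sum>s\<in>UNIV. \<Sum>u<k. PS s * P (r n) s u * b (xf u s)) = C (Suc (r n))" for n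
      using good_r[of n] by (simp add: good_def)
    ultimately have "(\<lambda>n. C ((Suc \<circ> r) n)) \<longlonglongrightarrow> (\<Sum>s\<in>UNIV. \<Sum>u<k. PS s * p s u * b (xf u s))" by simp
    then have "limsup (\<lambda>n. ereal (C ((Suc \<circ> r) n))) = ereal (\<Sum>s\<in>UNIV. \<Sum>u<k. PS s * p s u * b (xf u s))"
      by (intro lim_imp_Limsup) auto
    moreover have "limsup ((\<lambda>n. ereal (C n)) \<circ> (Suc \<circ> r)) \<le> limsup (\<lambda>n. ereal (C n))"
      by (rule limsup_subseq_mono[OF Sr])
    ultimately have "ereal (\<Sum>s\<in>UNIV. \<Sum>u<k. PS s * p s u * b (xf u s)) \<le> limsup (\<lambda>n. ereal (C n))"
      by (simp add: o_def)
    also have "\<dots> \<le> ereal B" using cost by (simp add: C_def)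
    finally show ?thesis by simp
  qed
  moreover have "(\<Sum>s\<in>UNIV. \<Sum>u<k. PS s * p s u * chanZ W s (xf u s) z) = Q z" for z
  proof -
    define L where "L z = (\<Sum>s\<in>UNIV. \<Sum>u<k. PS s * p s u * chanZ W s (xf u s) z)" for z
    \<comment> \<open>Letting the blocklength grow at fixed \<open>t\<close> removes the divergence
      term.\<close>
    have L_le: "L z \<le> Q z * ((exp t - 1) / t)" if t: "t > 0" for z t
    proof (rule LIMSEQ_le)
      show "(\<lambda>n. \<Sum>s\<in>UNIV. \<Sum>u<k. PS s * P (r n) s u * chanZ W s (xf u s) z) \<longlonglongrightarrow> L z"
        unfolding L_def by (intro tendsto_intros lim) simp
      have "(\<lambda>n. D n * (1 / real n) / t + Q z * ((exp t - 1) / t)) \<longlonglongrightarrow> 0 * 0 / t + Q z * ((exp t - 1) / t)"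
        using kl t by (intro tendsto_intros lim_1_over_n) (auto simp: D_def)
      then have "((\<lambda>n. D n / (real n * t) + Q z * ((exp t - 1) / t)) \<circ> (Suc \<circ> r)) \<longlonglongrightarrow> Q z * ((exp t - 1) / t)"
        by (intro LIMSEQ_subseq_LIMSEQ Sr) simp
      then show "(\<lambda>n. D (Suc (r n)) / (real (Suc (r n)) * t) + Q z * ((exp t - 1) / t)) \<longlonglongrightarrow> Q z * ((exp t - 1) / t)"
        by (simp only: o_def)
      show "\<exists>N. \<forall>n\<ge>N. (\<Sum>s\<in>UNIV. \<Sum>u<k. PS s * P (r n) s u * chanZ W s (xf u s) z)
          \<le> D (Suc (r n)) / (real (Suc (r n)) * t) + Q z * ((exp t - 1) / t)"
        using good_r t unfolding good_def by blast
    qed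
    have L_le_Q: "L z \<le> Q z" for z
    proof (rule LIMSEQ_le_const)
      show "(\<lambda>n. Q z * (1 + 1 / real n)) \<longlonglongrightarrow> Q z"
        using tendsto_mult_left[OF tendsto_add[OF tendsto_const lim_1_over_n], of "Q z" 1] by simp
      have "L z \<le> Q z * (1 + 1 / real n)" if "n \<ge> 1" for n
      proof -
        \<comment> \<open>Here \<open>n\<close> only drives \<open>t\<close> to 0 and is not a
          blocklength; \<open>exp t \<le> 1 + t + t\<^sup>2\<close> on the unit interval yields the
          factor \<open>1 + t\<close>.\<close>
        define t where "t = 1 / real n"
        have t: "t > 0" "t \<le> 1" using that by (auto simp: t_def)
        have "exp t \<le> 1 + t + t\<^sup>2" using t by (intro exp_bound) auto
        then have "(exp t - 1) / t \<le> 1 + t" using t by (simp add: field_simps power2_eq_square)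
        then have "Q z * ((exp t - 1) / t) \<le> Q z * (1 + t)"
          using Q[of z] by (intro mult_left_mono) auto
        then show ?thesis using L_le[OF t(1), of z] by (simp add: t_def)
      qed
      then show "\<exists>N. \<forall>n\<ge>N. L z \<le> Q z * (1 + 1 / real n)" by blast
    qed
    have "(\<Sum>z\<in>UNIV. L z) = (\<Sum>s\<in>UNIV. \<Sum>u<k. \<Sum>z\<in>UNIV. PS s * p s u * chanZ W s (xf u s) z)"
      unfolding L_def by (subst sum.swap, intro sum.cong refl, rule sum.swap)
    also have "\<dots> = 1" by (simp add: p1 PS1 flip: sum_distrib_left)
    finally have "(\<Sum>z\<in>UNIV. Q z - L z) = 0" using Q1 by (simp add: sum_subtractf)
    then have "\<forall>z\<in>UNIV. Q z - L z = 0"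
      using L_le_Q by (subst (asm) sum_nonneg_eq_0_iff) auto
    then show ?thesis by (simp add: L_def)
  qed
  moreover have "R \<le> nc_objective PS W k p xf"
  proof (rule LIMSEQ_le)
    have "(\<lambda>n. (1 - E n) * R - 1 / real n) \<longlonglongrightarrow> (1 - 0) * R - 0"
      using err by (intro tendsto_intros lim_1_over_n) (simp add: E_def)
    then have "((\<lambda>n. (1 - E n) * R - 1 / real n) \<circ> (Suc \<circ> r)) \<longlonglongrightarrow> R"
      by (intro LIMSEQ_subseq_LIMSEQ Sr) simp
    then show "(\<lambda>n. (1 - E (Suc (r n))) * R - 1 / real (Suc (r n))) \<longlonglongrightarrow> R" by (simp only: o_def)
    show "(\<lambda>n. nc_objective PS W k (P (r n)) xf) \<longlonglongrightarrow> nc_objective PS W k p xf"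
      using P01 by (intro tendsto_nc_objective lim PS0) auto
    show "\<exists>N. \<forall>n\<ge>N. (1 - E (Suc (r n))) * R - 1 / real (Suc (r n)) \<le> nc_objective PS W k (P (r n)) xf"
      using good_r unfolding good_def by blast
  qed
  ultimately show ?thesis
    unfolding nc_feasible_def Q_def by (intro exI[of _ p] exI[of _ xf]) (simp add: k_def)
qed

theorem theorem3:
  fixes PS :: "'s::finite \<Rightarrow> real"
    and W :: "'s \<Rightarrow> 'x::finite \<Rightarrow> 'y::finite \<Rightarrow> 'z::finite \<Rightarrow> real"
    and x0 :: 'x and b :: "'x \<Rightarrow> real" and RK B :: real
  assumes "is_pmf_on UNIV PS"
    and "\<forall>s x. is_pmf_on UNIV (\<lambda>yz. W s x (fst yz) (snd yz))"
    and "\<forall>x. b x \<ge> 0"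
    and "\<forall>z. Q0 PS W x0 z > 0"
    and "RK \<ge> 0" and "B \<ge> 0"
  shows "nc_covert_capacity PS W x0 b RK B \<le> nc_upper_bound PS W x0 b B"
proof -
  interpret channel W using assms(2) by unfold_locales auto
  show ?thesis
    unfolding nc_covert_capacity_def
  proof (rule Sup_least)
    fix v assume "v \<in> ereal ` {R. nc_achievable PS W x0 b RK B R}"
    then obtain R where v: "v = ereal R" and R: "nc_achievable PS W x0 b RK B R" by blast
    from achievable_imp_feasible[OF assms(1,4) R] obtain PUS xf
      where "nc_feasible PS W x0 b B (aux_bound TYPE('s) TYPE('x) TYPE('y) TYPE('z)) PUS xf"
        and le: "R \<le> nc_objective PS W (aux_bound TYPE('s) TYPE('x) TYPE('y) TYPE('z)) PUS xf" by blast
    then have "ereal (nc_objective PS W (aux_bound TYPE('s) TYPE('x) TYPE('y) TYPE('z)) PUS xf)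
        \<le> nc_upper_bound PS W x0 b B"
      unfolding nc_upper_bound_def by (intro Sup_upper) blast
    moreover have "v \<le> ereal (nc_objective PS W (aux_bound TYPE('s) TYPE('x) TYPE('y) TYPE('z)) PUS xf)"
      using le by (simp add: v)
    ultimately show "v \<le> nc_upper_bound PS W x0 b B" by (rule order.trans[rotated])
  qed
qed

end
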